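(* Let $d\ge 1$ be a fixed integer and let $\mathbf{q}=(q_1,\ldots,q_d)$ be a fixed vector of integers $q_i\ge 2$. For $\mathbf{q}$-pebbling on the grid $\mathcal{P}_n^d$, as $n\to\infty$, $$P_{1/2}\left(\mathcal{P}_n^d\right)=n^d\exp\left(\left(\frac{(d+1)!\,\log n\prod_{i=1}^d\log q_i}{2}\right)^{\frac{1}{d+1}}-\frac{d\log\log n}{d+1}+O(1)\right).$$
   Context: $\mathcal{P}_n^d$ is the $d$-dimensional grid graph with vertex set $[n]^d=\{1,\ldots,n\}^d$, two vertices being adjacent iff they differ by exactly $1$ in one coordinate and agree in all others. A configuration (distribution) of $k$ pebbles is a multiset of $k$ vertices, i.e. a function $D:[n]^d\to\mathbb{Z}_{\ge 0}$ with $\sum_w D(w)=k$ (pebbles are unlabelled). A $\mathbf{q}$-pebbling move in coordinate $i$ removes $q_i$ pebbles from a vertex $w$ and adds one pebble to a vertex adjacent to $w$ that differs from $w$ in coordinate $i$. A configuration is $v$-solvable if some finite (possibly empty) sequence of $\mathbf{q}$-pebbling moves leads to a configuration with at least one pebble on $v$, and it is solvable if it is $v$-solvable for every vertex $v$. For a graph $G$, $\mathcal{D}_{G,k}$ is the probability space of all configurations of $k$ unlabelled pebbles on $V(G)$, with the uniform distribution over all $\binom{|V(G)|+k-1}{k}$ configurations, and $$P_{1/2}(G)=\min\left\{k \;\middle|\; \mathbb{P}\left(D\in\mathcal{D}_{G,k}\text{ is solvable}\right)\ge\tfrac12\right\}.$$ Logarithms are natural; the $O(1)$ term is bounded as $n\to\infty$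 with $d$ and $\mathbf{q}$ fixed. *)

theory Defs
  imports "HOL-Probability.Probability" "HOL-Library.Multiset" "HOL-Library.Landau_Symbols"
begin

text \<open>A configuration of unlabelled pebbles is a multiset of vertices.\<close>

definition solvable_for ::
    "('v multiset \<Rightarrow> 'v multiset \<Rightarrow> bool) \<Rightarrow> 'v \<Rightarrow> 'v multiset \<Rightarrow> bool" where
  "solvable_for move v D \<longleftrightarrow> (\<exists>D'. move\<^sup>*\<^sup>* D D' \<and> v \<in># D')"

definition solvable ::
    "'v set \<Rightarrow> ('v multiset \<Rightarrow> 'v multiset \<Rightarrow> bool) \<Rightarrow> 'v multiset \<Rightarrow> bool" where
  "solvable V move D \<longleftrightarrow> (\<forall>v\<in>V. solvable_for move v D)"

text \<open>
  The uniform distribution is on multisets, so that a configuration is not weighted by the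
  number of its labellings. It is meaningful for finite nonempty \<open>V\<close>.
\<close>

definition P_half :: "'v set \<Rightarrow> ('v multiset \<Rightarrow> 'v multiset \<Rightarrow> bool) \<Rightarrow> nat" where
  "P_half V move =
     (LEAST k. measure_pmf.prob (pmf_of_set (multisets_of_size V k)) {D. solvable V move D} \<ge> 1 / 2)"

definition grid :: "nat \<Rightarrow> nat \<Rightarrow> (nat \<Rightarrow> nat) set" where
  "grid d n = {1..d} \<rightarrow>\<^sub>E {1..n}"

definition adjacent_in :: "nat \<Rightarrow> nat \<Rightarrow> (nat \<Rightarrow> nat) \<Rightarrow> (nat \<Rightarrow> nat) \<Rightarrow> bool" where
  "adjacent_in d i w w' \<longleftrightarrow>
     (w' i = w i + 1 \<or> w i = w' i + 1) \<and> (\<forall>j\<in>{1..d} - {i}. w' j = w j)"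

definition pebbling_move ::
    "nat \<Rightarrow> (nat \<Rightarrow> nat) \<Rightarrow> nat \<Rightarrow> (nat \<Rightarrow> nat) multiset \<Rightarrow> (nat \<Rightarrow> nat) multiset \<Rightarrow> bool" where
  "pebbling_move d q n D D' \<longleftrightarrow>
     (\<exists>i\<in>{1..d}. \<exists>w\<in>grid d n. \<exists>w'\<in>grid d n.
        adjacent_in d i w w' \<and> replicate_mset (q i) w \<subseteq># D \<and>
        D' = D - replicate_mset (q i) w + {#w'#})"

end

theory Submission
  imports Defs
begin

text \<open>
  Give a pebble at \<open>w\<close> the weight \<open>exp (- \<lambda>(v, w))\<close> with \<open>\<lambda>(v, w) = \<Sum>i. ln q\<^sub>i * \<bar>w\<^sub>i - v\<^sub>i\<bar>\<close>. No move
  increases the total weight and a move towards \<open>v\<close> preserves it, so \<open>v\<close>-solvability is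
  equivalent, up to a constant factor, to the total weight (the potential) being at least a
  constant.  With \<open>c\<close> pebbles per vertex, the potential at \<open>v\<close> is bounded with probability about
  \<open>exp (- \<Sum>w. max 0 (l - \<lambda>(v, w)))\<close> where \<open>l = ln c + d ln ln c + O(1)\<close>; the term \<open>d ln ln c\<close>
  is the logarithm of the number of relevant vertices, which share the bounded budget.  The sum is
  about \<open>2 ^ j * l ^ (d + 1) / ((d + 1)! \<Prod>i. ln q\<^sub>i)\<close> if \<open>j\<close> coordinates of \<open>v\<close> are far from the
  boundary, and there are about \<open>n ^ j\<close> such vertices.  As \<open>2 ^ j \<ge> 2 * j\<close> with equality for
  \<open>j = 1\<close>, the threshold is decided by the edges of the grid: there the union bound (for
  solvability) and \<open>n ^ (1 - o(1))\<close> disjoint, nearly independent neighbourhoods (for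
  unsolvability) meet.
\<close>

section \<open>Weights and solvability\<close>

text \<open>Let \<open>L\<close> solve \<open>2 * L ^ (d + 1) / \<kappa> = ln n\<close> with
  \<open>\<kappa> = fact (d + 1) * (\<Prod>i=1..d. ln (real (q i)))\<close>; an edge vertex with
  radius \<open>L\<close> fails with probability about 1/n. Changing the radius by a constant
  changes the exponent by order \<open>L ^ d\<close>. So errors of order \<open>L ^ d\<close> in the
  exponent and powers of \<open>L\<close> in front of it all disappear in the O(1). The counts of a
  uniform multiset are dependent, and the two directions treat this differently. The union bound
  sets probabilities of order 1/n against about n vertices and cannot lose a power of n; there the
  multisets with little weight near \<open>v\<close> are counted directly, as lattice points of a
  simplex. Unsolvability needs many independent blocks. Independent geometric counts conditioned on
  their total are uniform, and the conditioning costs a polynomial factor; this is affordable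
  because all chosen edge vertices escape failure only with probability at most
  \<open>exp (- ((2 * d + 2) * ln n + 5))\<close>. To keep a product form there, box constraints on
  single vertices replace the simplex.\<close>

definition wdist :: "('i \<Rightarrow> real) \<Rightarrow> 'i set \<Rightarrow> ('i \<Rightarrow> nat) \<Rightarrow> ('i \<Rightarrow> nat) \<Rightarrow> real" where
  "wdist a I v w = (\<Sum>i\<in>I. a i * \<bar>real (w i) - real (v i)\<bar>)"

abbreviation log_dist :: "nat \<Rightarrow> (nat \<Rightarrow> nat) \<Rightarrow> (nat \<Rightarrow> nat) \<Rightarrow> (nat \<Rightarrow> nat) \<Rightarrow> real" where
  "log_dist d q \<equiv> wdist (\<lambda>i. ln (real (q i))) {1..d}"

definition potential :: "nat \<Rightarrow> (nat \<Rightarrow> nat) \<Rightarrow> (nat \<Rightarrow> nat) \<Rightarrow> (nat \<Rightarrow> nat) multiset \<Rightarrow> real" where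
  "potential d q v D = (\<Sum>w\<in>#D. exp (- log_dist d q v w))"

lemma wdist_self [simp]: "wdist a I v v = 0"
  by (simp add: wdist_def)

lemma wdist_nonneg: "(\<And>i. i \<in> I \<Longrightarrow> a i \<ge> 0) \<Longrightarrow> wdist a I v w \<ge> 0"
  by (auto simp: wdist_def intro!: sum_nonneg)

lemma finite_grid [simp, intro]: "finite (grid d n)"
  by (simp add: grid_def finite_PiE)

lemma card_grid: "card (grid d n) = n ^ d"
  by (simp add: grid_def card_PiE)

lemma wdist_adjacent_in:
  assumes "adjacent_in d i w w'" "i \<in> {1..d}"
  shows "wdist a {1..d} v w' - wdist a {1..d} v w
       = a i * (\<bar>real (w' i) - real (v i)\<bar> - \<bar>real (w i) - real (v i)\<bar>)"
proof -
  have "(\<Sum>j\<in>{1..d} - {i}. a j * \<bar>real (w' j) - real (v j)\<bar>)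
      = (\<Sum>j\<in>{1..d} - {i}. a j * \<bar>real (w j) - real (v j)\<bar>)"
    using assms by (intro sum.cong) (auto simp: adjacent_in_def)
  thus ?thesis
    using assms(2) unfolding wdist_def
    by (subst (1 2) sum.remove[of "{1..d}" i]) (simp_all add: algebra_simps)
qed

text \<open>The new pebble is at most \<open>ln (q i)\<close> nearer to \<open>v\<close> than the
  removed ones, so it weighs at most \<open>q i\<close> times as much as one of them.\<close>

lemma potential_move:
  assumes mv: "pebbling_move d q n D D'" and q: "\<forall>i\<in>{1..d}. q i \<ge> 2"
  shows "potential d q v D' \<le> potential d q v D"
proof -
  obtain i w w' where i: "i \<in> {1..d}" and adj: "adjacent_in d i w w'"
    and sub: "replicate_mset (q i) w \<subseteq># D" and D': "D' = D - replicate_mset (q i) w + {#w'#}"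
    using mv by (auto simp: pebbling_move_def)
  have qi: "q i \<ge> 2" using q i by auto
  have "\<bar>real (w' i) - real (v i)\<bar> - \<bar>real (w i) - real (v i)\<bar> \<ge> -1"
    using adj by (auto simp: adjacent_in_def)
  hence "ln (real (q i)) * (\<bar>real (w' i) - real (v i)\<bar> - \<bar>real (w i) - real (v i)\<bar>) \<ge> ln (real (q i)) * (-1)"
    using qi by (intro mult_left_mono) auto
  hence "- log_dist d q v w' \<le> ln (real (q i)) - log_dist d q v w"
    using wdist_adjacent_in[OF adj i, of "\<lambda>i. ln (real (q i))" v] by simp
  hence "exp (- log_dist d q v w') \<le> exp (ln (real (q i)) - log_dist d q v w)"
    by simp
  also have "\<dots> = real (q i) * exp (- log_dist d q v w)"
    using qi by (simp add: exp_diff exp_minus field_simps)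
  finally have *: "exp (- log_dist d q v w') \<le> real (q i) * exp (- log_dist d q v w)" .
  obtain R where R: "D = replicate_mset (q i) w + R"
    using sub by (auto simp: subset_mset.le_iff_add)
  show ?thesis
    using * unfolding potential_def D' R by simp
qed

text \<open>A pebble on \<open>v\<close> alone has weight 1, and moves cannot raise the
  potential.\<close>

lemma one_le_potential_if_solvable_for:
  assumes "solvable_for (pebbling_move d q n) v D" and q: "\<forall>i\<in>{1..d}. q i \<ge> 2"
  shows "1 \<le> potential d q v D"
proof -
  obtain D' where mv: "(pebbling_move d q n)\<^sup>*\<^sup>* D D'" and v: "v \<in># D'"
    using assms(1) by (auto simp: solvable_for_def)
  from mv have le: "potential d q v D' \<le> potential d q v D"
    by induction (auto dest: potential_move[OF _ q, of _ _ _ v])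
  obtain R where R: "D' = add_mset v R"
    using v by (auto dest: multi_member_split)
  have "0 \<le> (\<Sum>w\<in>#R. exp (- log_dist d q v w))"
    by (induction R) (auto intro: add_nonneg_nonneg)
  hence "1 \<le> potential d q v D'"
    by (simp add: R potential_def)
  thus ?thesis using le by simp
qed

lemma solvable_for_move:
  assumes "solvable_for move v D'" "move D D'"
  shows "solvable_for move v D"
  using assms by (meson converse_rtranclp_into_rtranclp solvable_for_def)

lemma sum_mset_eq_sum_count:
  fixes f :: "'a \<Rightarrow> real"
  assumes "finite A" "set_mset D \<subseteq> A"
  shows "(\<Sum>w\<in>#D. f w) = (\<Sum>w\<in>A. real (count D w) * f w)"
  using assms(2)
proof (induction D)
  case (add x D)
  have "(\<Sum>w\<in>A. real (count (add_mset x D) w) * f w)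
      = (\<Sum>w\<in>A. real (count D w) * f w + (if w = x then f x else 0))"
    by (intro sum.cong) (auto simp: algebra_simps)
  with add assms(1) show ?case by (simp add: sum.distrib)
qed simp

lemma exists_step_towards:
  assumes "w \<in> grid d n" "v \<in> grid d n" "w \<noteq> v"
  obtains i w' where "i \<in> {1..d}" "w' \<in> grid d n" "adjacent_in d i w w'"
    "wdist a {1..d} v w' = wdist a {1..d} v w - a i"
proof -
  have "\<exists>i\<in>{1..d}. w i \<noteq> v i"
    using assms PiE_ext[of w "{1..d}" "\<lambda>_. {1..n}" v] by (auto simp: grid_def)
  then obtain i where i: "i \<in> {1..d}" "w i \<noteq> v i" by auto
  define w' where "w' = w(i := if w i < v i then w i + 1 else w i - 1)"
  have vi: "v i \<in> {1..n}" "w i \<in> {1..n}" using assms i unfolding grid_def by (auto dest: PiE_mem)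
  hence "(if w i < v i then w i + 1 else w i - 1) \<in> {1..n}" using i(2) by auto
  hence w': "w' \<in> grid d n"
    using assms(1) i(1) unfolding grid_def w'_def by (auto simp: PiE_iff extensional_def)
  have adj: "adjacent_in d i w w'"
    using i vi by (auto simp: adjacent_in_def w'_def)
  have "\<bar>real (w' i) - real (v i)\<bar> - \<bar>real (w i) - real (v i)\<bar> = -1"
    using i(2) vi by (auto simp: w'_def of_nat_diff)
  hence "wdist a {1..d} v w' = wdist a {1..d} v w - a i"
    using wdist_adjacent_in[OF adj i(1), of a v] by simp
  with i w' adj show ?thesis using that by blast
qed

text \<open>Moves towards \<open>v\<close> preserve the potential; when none is left, every vertex carries a
  bounded number of pebbles.\<close>

lemma solvable_for_if_potential_large:
  assumes q: "\<forall>i\<in>{1..d}. q i \<ge> 2" and v: "v \<in> grid d n" and D: "set_mset D \<subseteq> grid d n"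
    and Q: "\<forall>i\<in>{1..d}. q i \<le> Q"
    and big: "real Q * (\<Sum>w\<in>grid d n. exp (- log_dist d q v w)) < potential d q v D"
  shows "solvable_for (pebbling_move d q n) v D"
  using D big
\<comment> \<open>A move towards \<open>v\<close> keeps the potential and so the hypothesis
  \<open>big\<close>, while \<open>q i \<ge> 2\<close> makes the number of pebbles drop.\<close>
proof (induction "size D" arbitrary: D rule: less_induct)
  case less
  show ?case
  proof (cases "v \<in># D")
    case True
    thus ?thesis unfolding solvable_for_def by blast
  next
    case False
    have "\<exists>w\<in>grid d n. count D w > Q"
    proof (rule ccontr)
      assume neg: "\<not> ?thesis"
      have "potential d q v D = (\<Sum>w\<in>grid d n. real (count D w) * exp (- log_dist d q v w))"
        unfolding potential_def using less.prems by (intro sum_mset_eq_sum_count) auto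
      also have "\<dots> \<le> (\<Sum>w\<in>grid d n. real Q * exp (- log_dist d q v w))"
        using neg by (intro sum_mono mult_right_mono) (auto simp: not_less)
      also have "\<dots> = real Q * (\<Sum>w\<in>grid d n. exp (- log_dist d q v w))"
        by (simp add: sum_distrib_left)
      finally show False using less.prems by simp
    qed
    then obtain w where w: "w \<in> grid d n" "count D w > Q" by blast
    have "w \<noteq> v" using False w by (auto simp: not_in_iff)
    then obtain i w' where i: "i \<in> {1..d}" and w': "w' \<in> grid d n" "adjacent_in d i w w'"
      and eq: "log_dist d q v w' = log_dist d q v w - ln (real (q i))"
      using exists_step_towards[OF w(1) v, of "\<lambda>i. ln (real (q i))"] by blast
    have qi: "2 \<le> q i" "q i \<le> Q" using q Q i by auto
    have "replicate_mset (q i) w \<subseteq># D"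
      using w qi count_le_replicate_mset_subset_eq[of "q i" D w] by linarith
    then obtain R where R: "D = replicate_mset (q i) w + R"
      by (auto simp: subset_mset.le_iff_add)
    define D' where "D' = R + {#w'#}"
    have mv: "pebbling_move d q n D D'"
      unfolding pebbling_move_def using i w w' R by (intro bexI[of _ i] bexI[of _ w] bexI[of _ w']) (auto simp: D'_def)
    have "exp (- log_dist d q v w') = real (q i) * exp (- log_dist d q v w)"
      using qi unfolding eq by (simp add: exp_diff exp_minus field_simps)
    hence "potential d q v D' = potential d q v D"
      by (simp add: potential_def D'_def R)
    moreover have "size D' < size D" using qi by (simp add: D'_def R)
    moreover have "set_mset D' \<subseteq> grid d n"
      using less.prems w' by (auto simp: D'_def R)
    ultimately have "solvable_for (pebbling_move d q n) v D'"
      using less.hyps less.prems by simp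
    thus ?thesis using mv by (rule solvable_for_move)
  qed
qed

section \<open>Sums over the grid\<close>

text \<open>Discrete mean value theorem: \<open>u ^ Suc m - w ^ Suc m\<close> is
  \<open>u - w\<close> times a sum of \<open>Suc m\<close> terms, each between \<open>w ^ m\<close>
  and \<open>u ^ m\<close>.\<close>

lemma power_Suc_diff_bounds:
  fixes u w :: real
  assumes "0 \<le> w" "w \<le> u"
  shows "real (Suc m) * (u - w) * w ^ m \<le> u ^ Suc m - w ^ Suc m"
    and "u ^ Suc m - w ^ Suc m \<le> real (Suc m) * (u - w) * u ^ m"
proof -
  have eq: "u ^ Suc m - w ^ Suc m = (u - w) * (\<Sum>p<Suc m. u ^ p * w ^ (m - p))"
    by (rule diff_power_eq_sum)
  have lo: "w ^ m \<le> u ^ p * w ^ (m - p)" and hi: "u ^ p * w ^ (m - p) \<le> u ^ m" if "p < Suc m" for p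
  proof -
    have *: "w ^ m = w ^ p * w ^ (m - p)" "u ^ m = u ^ p * u ^ (m - p)"
      using that by (simp_all flip: power_add)
    show "w ^ m \<le> u ^ p * w ^ (m - p)" "u ^ p * w ^ (m - p) \<le> u ^ m"
      unfolding * using assms by (auto intro!: mult_mono power_mono)
  qed
  have "(\<Sum>p<Suc m. w ^ m) \<le> (\<Sum>p<Suc m. u ^ p * w ^ (m - p))"
    by (intro sum_mono lo) auto
  hence "(u - w) * (\<Sum>p<Suc m. w ^ m) \<le> (u - w) * (\<Sum>p<Suc m. u ^ p * w ^ (m - p))"
    using assms by (intro mult_left_mono) auto
  thus "real (Suc m) * (u - w) * w ^ m \<le> u ^ Suc m - w ^ Suc m"
    unfolding eq by (simp add: mult_ac)
  have "(\<Sum>p<Suc m. u ^ p * w ^ (m - p)) \<le> (\<Sum>p<Suc m. u ^ m)"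
    by (intro sum_mono hi) auto
  hence "(u - w) * (\<Sum>p<Suc m. u ^ p * w ^ (m - p)) \<le> (u - w) * (\<Sum>p<Suc m. u ^ m)"
    using assms by (intro mult_left_mono) auto
  thus "u ^ Suc m - w ^ Suc m \<le> real (Suc m) * (u - w) * u ^ m"
    unfolding eq by (simp add: mult_ac)
qed

text \<open>Comparison of a sum with the integral of \<open>(y - a * x) ^ m\<close>, carried out by
  telescoping the antiderivative. The sum starts at 1, hence \<open>y - a\<close>; the hypothesis
  \<open>y \<le> a * real X\<close> makes the far end of the telescope vanish.\<close>

lemma sum_pos_part_power_ge:
  fixes a y :: real
  assumes a: "0 < a" and X: "y \<le> a * real X"
  shows "max 0 (y - a) ^ Suc m / (real (Suc m) * a) \<le> (\<Sum>x=1..X. max 0 (y - a * real x) ^ m)"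
proof -
  define g where "g x = max 0 (y - a * real x) ^ Suc m" for x :: nat
  have step: "g x - g (Suc x) \<le> real (Suc m) * a * max 0 (y - a * real x) ^ m" for x
  proof -
    let ?u = "max 0 (y - a * real x)" and ?w = "max 0 (y - a * real (Suc x))"
    have "y - a * real (Suc x) = y - a * real x - a" by (simp add: algebra_simps)
    hence *: "0 \<le> ?w" "?w \<le> ?u" "?u - ?w \<le> a" using a by auto
    have "g x - g (Suc x) \<le> real (Suc m) * (?u - ?w) * ?u ^ m"
      unfolding g_def by (rule power_Suc_diff_bounds(2)) (use * in auto)
    also have "\<dots> \<le> real (Suc m) * a * ?u ^ m"
      using * by (intro mult_right_mono mult_left_mono) auto
    finally show ?thesis .
  qed
  have "g (Suc X) = 0"
    using X a unfolding g_def by (simp add: algebra_simps)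
  moreover have "(\<Sum>x=1..X. g x - g (Suc x)) = g 1 - g (Suc X)"
    by (induction X) auto
  moreover have "g 1 = max 0 (y - a) ^ Suc m" by (simp add: g_def)
  ultimately have "max 0 (y - a) ^ Suc m = (\<Sum>x=1..X. g x - g (Suc x))" by simp
  also have "\<dots> \<le> (\<Sum>x=1..X. real (Suc m) * a * max 0 (y - a * real x) ^ m)"
    by (intro sum_mono step)
  also have "\<dots> = real (Suc m) * a * (\<Sum>x=1..X. max 0 (y - a * real x) ^ m)"
    by (rule sum_distrib_left [symmetric])
  finally show ?thesis
    using a by (subst pos_divide_le_eq) (simp_all only: mult_ac mult_pos_pos of_nat_0_less_iff zero_less_Suc)
qed

text \<open>The same telescope in the other direction. For \<open>m = 0\<close> a summand is 1 even
  where \<open>y - a * x\<close> is negative, as \<open>0 ^ 0 = 1\<close>; the range then has to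
  satisfy \<open>a * real X \<le> y\<close>. That case is met when the first coordinate is added in
  the lattice point count.\<close>

lemma sum_pos_part_power_le:
  fixes a y :: real
  assumes a: "0 < a" and m: "0 < m \<or> a * real X \<le> y"
  shows "(\<Sum>x\<le>X. max 0 (y - a * real x) ^ m) \<le> max 0 (y + a) ^ Suc m / (real (Suc m) * a)"
proof -
  define g where "g x = max 0 (y + a - a * real x) ^ Suc m" for x :: nat
  have step: "real (Suc m) * a * max 0 (y - a * real x) ^ m \<le> g x - g (Suc x)" if x: "x \<le> X" for x
  proof -
    let ?u = "max 0 (y + a - a * real x)" and ?w = "max 0 (y - a * real x)"
    have e: "y + a - a * real (Suc x) = y - a * real x" by (simp add: algebra_simps)
    have *: "0 \<le> ?w" "?w \<le> ?u" using a by auto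
    have "real (Suc m) * a * ?w ^ m \<le> real (Suc m) * (?u - ?w) * ?w ^ m"
    proof (cases "0 \<le> y - a * real x")
      case True thus ?thesis using a by (simp add: algebra_simps)
    next
      case False
      have "a * real x \<le> a * real X" using a x by simp
      with False m have "0 < m" by linarith
      with False show ?thesis by (simp add: zero_power)
    qed
    also have "\<dots> \<le> ?u ^ Suc m - ?w ^ Suc m" by (rule power_Suc_diff_bounds(1)) (use * in auto)
    finally show ?thesis unfolding g_def e .
  qed
  have "(\<Sum>x\<le>X. real (Suc m) * a * max 0 (y - a * real x) ^ m) \<le> (\<Sum>x\<le>X. g x - g (Suc x))"
    by (intro sum_mono step) auto
  also have "\<dots> = g 0 - g (Suc X)" by (rule sum_telescope)
  also have "\<dots> \<le> g 0" by (simp add: g_def)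
  also have "g 0 = max 0 (y + a) ^ Suc m" by (simp add: g_def)
  also have "(\<Sum>x\<le>X. real (Suc m) * a * max 0 (y - a * real x) ^ m)
      = real (Suc m) * a * (\<Sum>x\<le>X. max 0 (y - a * real x) ^ m)"
    by (rule sum_distrib_left [symmetric])
  finally show ?thesis
    using a by (subst pos_le_divide_eq) (simp_all only: mult_ac mult_pos_pos of_nat_0_less_iff zero_less_Suc)
qed

text \<open>Both \<open>t - h\<close> and \<open>t + h\<close> lie in \<open>{1..n}\<close>, so the
  neighbourhood of radius \<open>h\<close> is cut off at neither end.\<close>

definition deep :: "nat \<Rightarrow> nat \<Rightarrow> nat \<Rightarrow> bool" where
  "deep n h t \<longleftrightarrow> h < t \<and> t + h \<le> n"

text \<open>Each side of \<open>v\<close> gives the one-sided bound if it extends over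
  \<open>h\<close> steps. As \<open>2 * h + 1 \<le> n\<close>, at least one side does, and both do
  if \<open>v\<close> is deep; the centre is dropped.\<close>

lemma sum_around_ge:
  fixes a y :: real
  assumes a: "0 < a" and h: "y \<le> a * real h" and n: "2 * h + 1 \<le> n" and v: "v \<in> {1..n}"
  shows "(if deep n h v then 2 else 1) * (max 0 (y - a) ^ Suc m / (real (Suc m) * a))
       \<le> (\<Sum>t=1..n. max 0 (y - a * \<bar>real t - real v\<bar>) ^ m)"
proof -
  let ?f = "\<lambda>t. max 0 (y - a * \<bar>real t - real v\<bar>) ^ m" and ?B = "max 0 (y - a) ^ Suc m / (real (Suc m) * a)"
  have B0: "0 \<le> ?B" using a by simp
  have r: "(\<Sum>t\<in>{v<..n}. ?f t) = (\<Sum>x=1..n - v. max 0 (y - a * real x) ^ m)"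
    by (rule sum.reindex_bij_witness[of _ "\<lambda>x. v + x" "\<lambda>t. t - v"]) (auto simp: of_nat_diff)
  have l: "(\<Sum>t\<in>{1..<v}. ?f t) = (\<Sum>x=1..v - 1. max 0 (y - a * real x) ^ m)"
    by (rule sum.reindex_bij_witness[of _ "\<lambda>x. v - x" "\<lambda>t. v - t"]) (auto simp: of_nat_diff)
  have R: "?B \<le> (\<Sum>t\<in>{v<..n}. ?f t)" if "h \<le> n - v"
    unfolding r using a h that by (intro sum_pos_part_power_ge) (auto intro: order.trans mult_left_mono)
  have L: "?B \<le> (\<Sum>t\<in>{1..<v}. ?f t)" if "h \<le> v - 1"
    unfolding l using a h that by (intro sum_pos_part_power_ge) (auto intro: order.trans mult_left_mono)
  have "(\<Sum>t\<in>{1..<v} \<union> {v<..n}. ?f t) \<le> (\<Sum>t=1..n. ?f t)"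
    using v by (intro sum_mono2) auto
  hence *: "(\<Sum>t\<in>{1..<v}. ?f t) + (\<Sum>t\<in>{v<..n}. ?f t) \<le> (\<Sum>t=1..n. ?f t)"
    by (subst (asm) sum.union_disjoint) auto
  have nn: "0 \<le> (\<Sum>t\<in>{1..<v}. ?f t)" "0 \<le> (\<Sum>t\<in>{v<..n}. ?f t)"
    by (auto intro!: sum_nonneg)
  consider "deep n h v" | "\<not> deep n h v" "h \<le> n - v" | "\<not> deep n h v" "h \<le> v - 1"
    using n by linarith
  thus ?thesis
  proof cases
    case 1
    hence "h \<le> n - v" "h \<le> v - 1" by (auto simp: deep_def)
    thus ?thesis using 1 * L R by simp
  qed (use * L R nn in auto)
qed

text \<open>Two one-sided sums cover the range, the centre being included in both bounds. Of the two
  ends \<open>v = 1\<close> gets the factor 1, since the edge vertices chosen later have all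
  coordinates but the first equal to 1.\<close>

lemma sum_around_le:
  fixes a y :: real
  assumes a: "0 < a" and m: "0 < m" and v: "v \<in> {1..n}"
  shows "(\<Sum>t=1..n. max 0 (y - a * \<bar>real t - real v\<bar>) ^ m)
       \<le> (if v = 1 then 1 else 2) * (max 0 (y + a) ^ Suc m / (real (Suc m) * a))"
proof -
  let ?f = "\<lambda>t. max 0 (y - a * \<bar>real t - real v\<bar>) ^ m" and ?B = "max 0 (y + a) ^ Suc m / (real (Suc m) * a)"
  have B0: "0 \<le> ?B" using a by simp
  have r: "(\<Sum>t\<in>{v..n}. ?f t) = (\<Sum>x\<le>n - v. max 0 (y - a * real x) ^ m)"
    using v by (intro sum.reindex_bij_witness[of _ "\<lambda>x. v + x" "\<lambda>t. t - v"]) (auto simp: of_nat_diff)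
  have l: "(\<Sum>t\<in>{1..v}. ?f t) = (\<Sum>x\<le>v - 1. max 0 (y - a * real x) ^ m)"
    using v by (intro sum.reindex_bij_witness[of _ "\<lambda>x. v - x" "\<lambda>t. v - t"]) (auto simp: of_nat_diff)
  have R: "(\<Sum>t\<in>{v..n}. ?f t) \<le> ?B" and L: "(\<Sum>t\<in>{1..v}. ?f t) \<le> ?B"
    unfolding r l using a m by (intro sum_pos_part_power_le; simp)+
  show ?thesis
  proof (cases "v = 1")
    case False
    have "(\<Sum>t=1..n. ?f t) = (\<Sum>t\<in>{1..v} \<union> {v<..n}. ?f t)"
      using v by (intro sum.cong) auto
    also have "\<dots> = (\<Sum>t\<in>{1..v}. ?f t) + (\<Sum>t\<in>{v<..n}. ?f t)"
      by (rule sum.union_disjoint) auto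
    also have "(\<Sum>t\<in>{v<..n}. ?f t) \<le> (\<Sum>t\<in>{v..n}. ?f t)"
      by (intro sum_mono2) auto
    finally show ?thesis using L R False by simp
  qed (use R in simp)
qed

lemma sum_PiE_insert:
  assumes "i \<notin> I"
  shows "(\<Sum>w\<in>PiE (insert i I) B. f w) = (\<Sum>t\<in>B i. \<Sum>g\<in>PiE I B. f (g(i := t)))"
proof -
  have "(\<Sum>w\<in>PiE (insert i I) B. f w) = (\<Sum>(t, g)\<in>B i \<times> PiE I B. f (g(i := t)))"
    unfolding PiE_insert_eq using assms
    by (subst sum.reindex[OF inj_combinator]) (auto simp: case_prod_unfold)
  thus ?thesis by (simp add: sum.cartesian_product)
qed

text \<open>The inductions over the set of coordinates rest on this; it is the reason why
  \<open>wdist\<close> takes an arbitrary index set.\<close>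

lemma wdist_insert:
  assumes "finite I" "i \<notin> I"
  shows "wdist a (insert i I) v (g(i := t)) = a i * \<bar>real t - real (v i)\<bar> + wdist a I v g"
proof -
  have "wdist a I v (g(i := t)) = wdist a I v g"
    unfolding wdist_def using assms by (intro sum.cong) auto
  thus ?thesis using assms by (simp add: wdist_def)
qed

text \<open>Discrete volume of a weighted simplex. Starting from exponent 1, each further coordinate
  raises the exponent from \<open>m\<close> to \<open>Suc m\<close> and divides by
  \<open>Suc m * a i\<close>, which builds up the factorial; a coordinate with room on both sides
  doubles the sum. Replacing sums by integrals shifts \<open>l\<close> by \<open>a i\<close> per
  coordinate.\<close>

lemma sum_pos_part_wdist_ge:
  fixes a :: "'i \<Rightarrow> real"
  assumes "finite I" and "\<And>i. i \<in> I \<Longrightarrow> 0 < a i" and "\<And>i. i \<in> I \<Longrightarrow> l \<le> a i * real h"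
    and "\<And>i. i \<in> I \<Longrightarrow> v i \<in> {1..n}" and n: "2 * h + 1 \<le> n"
  shows "(\<Prod>i\<in>I. if deep n h (v i) then 2 else 1) *
           (max 0 (l - (\<Sum>i\<in>I. a i)) ^ Suc (card I) / (fact (Suc (card I)) * (\<Prod>i\<in>I. a i)))
       \<le> (\<Sum>w\<in>PiE I (\<lambda>_. {1..n}). max 0 (l - wdist a I v w))"
  using assms(1-4)
proof (induction arbitrary: l rule: finite_induct)
  case empty
  thus ?case by (simp add: wdist_def)
next
  case (insert i I)
  let ?mu = "\<lambda>i. if deep n h (v i) then 2 else (1::real)"
  let ?s = "\<Sum>i\<in>I. a i" and ?m = "Suc (card I)"
  define C where "C = (\<Prod>i\<in>I. ?mu i) / (fact ?m * (\<Prod>i\<in>I. a i))"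
  have ai: "0 < a i" using insert.prems by simp
  have s0: "0 \<le> ?s" using insert.prems by (intro sum_nonneg) (auto intro: less_imp_le)
  have C0: "0 \<le> C" unfolding C_def using insert.prems
    by (intro divide_nonneg_nonneg mult_nonneg_nonneg prod_nonneg) (auto intro: less_imp_le)
  \<comment> \<open>Fixing coordinate \<open>i\<close> at \<open>t\<close> uses up
    \<open>a i * \<bar>t - v i\<bar>\<close> of the budget \<open>l\<close>; for this the induction
    leaves \<open>l\<close> arbitrary.\<close>
  have IH: "C * max 0 ((l - ?s) - a i * \<bar>real t - real (v i)\<bar>) ^ ?m
      \<le> (\<Sum>g\<in>PiE I (\<lambda>_. {1..n}). max 0 (l - wdist a (insert i I) v (g(i := t))))" for t
  proof -
    let ?l = "l - a i * \<bar>real t - real (v i)\<bar>"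
    have "?l \<le> l" using ai by simp
    hence "\<And>j. j \<in> I \<Longrightarrow> ?l \<le> a j * real h" using insert.prems by (meson insertI2 order.trans)
    hence "(\<Prod>i\<in>I. ?mu i) * (max 0 (?l - ?s) ^ ?m / (fact ?m * (\<Prod>i\<in>I. a i)))
        \<le> (\<Sum>w\<in>PiE I (\<lambda>_. {1..n}). max 0 (?l - wdist a I v w))"
      using insert.prems by (intro insert.IH) auto
    moreover have "?l - ?s = (l - ?s) - a i * \<bar>real t - real (v i)\<bar>" by simp
    ultimately show ?thesis
      using insert.hyps by (simp add: C_def wdist_insert algebra_simps)
  qed
  have "(\<Prod>i\<in>insert i I. ?mu i) * (max 0 (l - (\<Sum>i\<in>insert i I. a i)) ^ Suc (card (insert i I))
       / (fact (Suc (card (insert i I))) * (\<Prod>i\<in>insert i I. a i)))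
     = C * (?mu i * (max 0 ((l - ?s) - a i) ^ Suc ?m / (real (Suc ?m) * a i)))"
    using insert.hyps by (simp add: C_def algebra_simps)
  also have "\<dots> \<le> C * (\<Sum>t=1..n. max 0 ((l - ?s) - a i * \<bar>real t - real (v i)\<bar>) ^ ?m)"
  proof (intro mult_left_mono C0 sum_around_ge ai n)
    have "l \<le> a i * real h" using insert.prems by simp
    thus "l - ?s \<le> a i * real h" using s0 by linarith
    show "v i \<in> {1..n}" using insert.prems by simp
  qed
  also have "\<dots> = (\<Sum>t=1..n. C * max 0 ((l - ?s) - a i * \<bar>real t - real (v i)\<bar>) ^ ?m)"
    by (simp add: sum_distrib_left)
  also have "\<dots> \<le> (\<Sum>t=1..n. \<Sum>g\<in>PiE I (\<lambda>_. {1..n}). max 0 (l - wdist a (insert i I) v (g(i := t))))"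
    by (intro sum_mono IH)
  also have "\<dots> = (\<Sum>w\<in>PiE (insert i I) (\<lambda>_. {1..n}). max 0 (l - wdist a (insert i I) v w))"
    using insert.hyps by (simp add: sum_PiE_insert)
  finally show ?case .
qed

text \<open>The mirror image of \<open>sum_pos_part_wdist_ge\<close>: the integrals now bound the
  sums from above, which shifts \<open>l\<close> upwards by the same
  \<open>\<Sum>i\<in>I. a i\<close>.\<close>

lemma sum_pos_part_wdist_le:
  fixes a :: "'i \<Rightarrow> real"
  assumes "finite I" and "\<And>i. i \<in> I \<Longrightarrow> 0 < a i" and "\<And>i. i \<in> I \<Longrightarrow> v i \<in> {1..n}"
  shows "(\<Sum>w\<in>PiE I (\<lambda>_. {1..n}). max 0 (l - wdist a I v w))
       \<le> (\<Prod>i\<in>I. if v i = 1 then 1 else 2) *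
           (max 0 (l + (\<Sum>i\<in>I. a i)) ^ Suc (card I) / (fact (Suc (card I)) * (\<Prod>i\<in>I. a i)))"
  using assms
proof (induction arbitrary: l rule: finite_induct)
  case empty
  thus ?case by (simp add: wdist_def)
next
  case (insert i I)
  let ?mu = "\<lambda>i. if v i = 1 then 1 else (2::real)"
  let ?s = "\<Sum>i\<in>I. a i" and ?m = "Suc (card I)"
  define C where "C = (\<Prod>i\<in>I. ?mu i) / (fact ?m * (\<Prod>i\<in>I. a i))"
  have ai: "0 < a i" using insert.prems by simp
  have C0: "0 \<le> C" unfolding C_def using insert.prems
    by (intro divide_nonneg_nonneg mult_nonneg_nonneg prod_nonneg) (auto intro: less_imp_le)
  have IH: "(\<Sum>g\<in>PiE I (\<lambda>_. {1..n}). max 0 (l - wdist a (insert i I) v (g(i := t))))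
      \<le> C * max 0 ((l + ?s) - a i * \<bar>real t - real (v i)\<bar>) ^ ?m" for t
  proof -
    let ?l = "l - a i * \<bar>real t - real (v i)\<bar>"
    have "(\<Sum>w\<in>PiE I (\<lambda>_. {1..n}). max 0 (?l - wdist a I v w))
      \<le> (\<Prod>i\<in>I. ?mu i) * (max 0 (?l + ?s) ^ ?m / (fact ?m * (\<Prod>i\<in>I. a i)))"
      using insert.prems by (intro insert.IH) auto
    moreover have "?l + ?s = (l + ?s) - a i * \<bar>real t - real (v i)\<bar>" by simp
    ultimately show ?thesis
      using insert.hyps by (simp add: C_def wdist_insert algebra_simps)
  qed
  have "(\<Sum>w\<in>PiE (insert i I) (\<lambda>_. {1..n}). max 0 (l - wdist a (insert i I) v w))
      = (\<Sum>t=1..n. \<Sum>g\<in>PiE I (\<lambda>_. {1..n}). max 0 (l - wdist a (insert i I) v (g(i := t))))"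
    using insert.hyps by (simp add: sum_PiE_insert)
  also have "\<dots> \<le> (\<Sum>t=1..n. C * max 0 ((l + ?s) - a i * \<bar>real t - real (v i)\<bar>) ^ ?m)"
    by (intro sum_mono IH)
  also have "\<dots> = C * (\<Sum>t=1..n. max 0 ((l + ?s) - a i * \<bar>real t - real (v i)\<bar>) ^ ?m)"
    by (simp add: sum_distrib_left)
  also have "\<dots> \<le> C * (?mu i * (max 0 ((l + ?s) + a i) ^ Suc ?m / (real (Suc ?m) * a i)))"
    using insert.prems by (intro mult_left_mono C0 sum_around_le ai) auto
  also have "\<dots> = (\<Prod>i\<in>insert i I. ?mu i) * (max 0 (l + (\<Sum>i\<in>insert i I. a i)) ^ Suc (card (insert i I))
       / (fact (Suc (card (insert i I))) * (\<Prod>i\<in>insert i I. a i)))"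
    using insert.hyps by (simp add: C_def algebra_simps)
  finally show ?case .
qed

section \<open>Exponential sums over the grid\<close>

lemma sum_exp_neg_le:
  fixes x :: real
  assumes "0 < x"
  shows "(\<Sum>i\<le>n. exp (- (x * real i))) \<le> 1 + 1 / x"
proof -
  have e: "exp (- (x * real i)) = exp (- x) ^ i" for i
    by (simp flip: exp_of_nat_mult add: mult.commute)
  have "(\<Sum>i\<le>n. exp (- (x * real i))) = (\<Sum>i<Suc n. exp (- x) ^ i)"
    unfolding e lessThan_Suc_atMost ..
  also have "\<dots> = (1 - exp (- x) ^ Suc n) / (1 - exp (- x))"
    using assms by (subst sum_gp_strict) auto
  also have "\<dots> \<le> 1 / (1 - exp (- x))"
    using assms by (intro divide_right_mono) auto
  also have "\<dots> \<le> 1 + 1 / x"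
  proof -
    have "exp (- x) \<le> 1 / (1 + x)"
      using exp_ge_add_one_self[of x] assms by (simp add: exp_minus field_simps)
    hence "x / (1 + x) \<le> 1 - exp (- x)" using assms by (simp add: field_simps)
    hence "1 / (1 - exp (- x)) \<le> 1 / (x / (1 + x))"
      using assms by (intro divide_left_mono) auto
    thus ?thesis using assms by (simp add: field_simps)
  qed
  finally show ?thesis .
qed

text \<open>The summand is a product over the coordinates, and each coordinate gives at most two
  geometric series. The case \<open>t = 1\<close> bounds the total weight of the grid; for small
  \<open>t\<close> the bound grows like \<open>1 / t\<close> to the power
  \<open>card I\<close>.\<close>

lemma sum_exp_wdist_le:
  fixes a :: "'i \<Rightarrow> real"
  assumes I: "finite I" and a: "\<And>i. i \<in> I \<Longrightarrow> 0 < a i" and v: "\<And>i. i \<in> I \<Longrightarrow> v i \<in> {1..n}"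
    and t: "0 < t"
  shows "(\<Sum>w\<in>PiE I (\<lambda>_. {1..n}). exp (- (t * wdist a I v w))) \<le> (\<Prod>i\<in>I. 2 * (1 + 1 / (t * a i)))"
proof -
  have "(\<Sum>w\<in>PiE I (\<lambda>_. {1..n}). exp (- (t * wdist a I v w)))
      = (\<Sum>w\<in>PiE I (\<lambda>_. {1..n}). \<Prod>i\<in>I. exp (- (t * a i * \<bar>real (w i) - real (v i)\<bar>)))"
    using I by (simp add: wdist_def sum_distrib_left exp_sum mult.assoc flip: sum_negf)
  also have "\<dots> = (\<Prod>i\<in>I. \<Sum>y=1..n. exp (- (t * a i * \<bar>real y - real (v i)\<bar>)))"
    using I by (subst prod_sum_PiE) auto
  also have "\<dots> \<le> (\<Prod>i\<in>I. 2 * (1 + 1 / (t * a i)))"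
  proof (intro prod_mono conjI sum_nonneg)
    fix i assume i: "i \<in> I"
    let ?f = "\<lambda>y. exp (- (t * a i * \<bar>real y - real (v i)\<bar>))"
    have ta: "0 < t * a i" using t a[OF i] by simp
    have vi: "v i \<in> {1..n}" using v i by simp
    have r: "(\<Sum>y\<in>{v i..n}. ?f y) = (\<Sum>x\<le>n - v i. exp (- (t * a i * real x)))"
      using vi by (intro sum.reindex_bij_witness[of _ "\<lambda>x. v i + x" "\<lambda>y. y - v i"]) (auto simp: of_nat_diff)
    have l: "(\<Sum>y\<in>{1..v i}. ?f y) = (\<Sum>x\<le>v i - 1. exp (- (t * a i * real x)))"
      using vi by (intro sum.reindex_bij_witness[of _ "\<lambda>x. v i - x" "\<lambda>y. v i - y"]) (auto simp: of_nat_diff)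
    have "(\<Sum>y=1..n. ?f y) = (\<Sum>y\<in>{1..v i} \<union> {v i<..n}. ?f y)"
      using vi by (intro sum.cong) auto
    also have "\<dots> = (\<Sum>y\<in>{1..v i}. ?f y) + (\<Sum>y\<in>{v i<..n}. ?f y)"
      by (rule sum.union_disjoint) auto
    also have "(\<Sum>y\<in>{v i<..n}. ?f y) \<le> (\<Sum>y\<in>{v i..n}. ?f y)"
      by (intro sum_mono2) auto
    finally have "(\<Sum>y=1..n. ?f y) \<le> (\<Sum>y\<in>{1..v i}. ?f y) + (\<Sum>y\<in>{v i..n}. ?f y)" by simp
    thus "(\<Sum>y=1..n. ?f y) \<le> 2 * (1 + 1 / (t * a i))"
      unfolding r l mult_2 by (rule order.trans) (intro add_mono sum_exp_neg_le ta)
  qed auto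
  finally show ?thesis .
qed

section \<open>Uniformly random multisets\<close>

text \<open>The unit cubes at the lattice points of the simplex fit into the simplex with
  \<open>K\<close> enlarged by \<open>\<Sum>w\<in>S. u w\<close>, whose volume is the bound. The
  proof slices along one coordinate and sums the slices by
  \<open>sum_pos_part_power_le\<close>.\<close>

lemma card_simplex_le:
  fixes u :: "'v \<Rightarrow> real"
  assumes "finite S" and "\<And>w. w \<in> S \<Longrightarrow> 0 < u w"
  defines "A \<equiv> \<lambda>K. {f \<in> S \<rightarrow>\<^sub>E (UNIV :: nat set). (\<Sum>w\<in>S. u w * real (f w)) \<le> K}"
  shows "finite (A K) \<and>
    real (card (A K)) \<le> max 0 (K + (\<Sum>w\<in>S. u w)) ^ card S / (fact (card S) * (\<Prod>w\<in>S. u w))"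
  using assms(1,2) unfolding A_def
proof (induction arbitrary: K rule: finite_induct)
  case empty
  show ?case by (cases "0 \<le> K") auto
next
  case (insert i S)
  define A where "A K = {f \<in> S \<rightarrow>\<^sub>E (UNIV :: nat set). (\<Sum>w\<in>S. u w * real (f w)) \<le> K}" for K
  define A' where "A' = {f \<in> insert i S \<rightarrow>\<^sub>E (UNIV :: nat set). (\<Sum>w\<in>insert i S. u w * real (f w)) \<le> K}"
  define C where "C = fact (card S) * (\<Prod>w\<in>S. u w)"
  let ?U = "\<Sum>w\<in>S. u w"
  have ui: "0 < u i" using insert.prems by simp
  have U0: "0 \<le> ?U" using insert.prems by (intro sum_nonneg) (auto intro: less_imp_le)
  have C0: "0 < C" unfolding C_def using insert.prems by (intro mult_pos_pos prod_pos) auto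
  have IH: "finite (A K)" "real (card (A K)) \<le> max 0 (K + ?U) ^ card S / C" for K
    using insert.IH[of K] insert.prems by (auto simp: A_def C_def)
  have "finite A' \<and> real (card A') \<le> max 0 (K + u i + ?U) ^ Suc (card S) / (real (Suc (card S)) * u i * C)"
  proof (cases "0 \<le> K")
    case False
    have "(\<Sum>w\<in>insert i S. u w * real (f w)) \<ge> 0" for f
      using insert.prems by (intro sum_nonneg mult_nonneg_nonneg) (auto intro: less_imp_le)
    hence "f \<notin> A'" for f
      unfolding A'_def mem_Collect_eq using False by (meson order.trans)
    hence "A' = {}" by blast
    thus ?thesis using ui C0 by simp
  next
    case True
    \<comment> \<open>The largest value coordinate \<open>i\<close> can take; it keeps the slices in
      the range where the sum bound holds even for empty \<open>S\<close>.\<close>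
    define X where "X = nat \<lfloor>K / u i\<rfloor>"
    have X: "real X \<le> K / u i" using True ui by (simp add: X_def)
    have "A' \<subseteq> (\<Union>t\<le>X. (\<lambda>g. g(i := t)) ` A (K - u i * real t))"
    proof
      fix f assume f: "f \<in> A'"
      define g where "g = f(i := undefined)"
      have fE: "f \<in> insert i S \<rightarrow>\<^sub>E UNIV" and le: "(\<Sum>w\<in>insert i S. u w * real (f w)) \<le> K"
        using f by (auto simp: A'_def)
      have g: "g \<in> S \<rightarrow>\<^sub>E UNIV" using fE insert.hyps by (auto simp: g_def PiE_iff extensional_def)
      have "(\<Sum>w\<in>S. u w * real (g w)) = (\<Sum>w\<in>S. u w * real (f w))"
        using insert.hyps by (intro sum.cong) (auto simp: g_def)
      moreover have "0 \<le> (\<Sum>w\<in>S. u w * real (f w))"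
        using insert.prems by (intro sum_nonneg mult_nonneg_nonneg) (auto intro: less_imp_le)
      ultimately have gA: "g \<in> A (K - u i * real (f i))" and "u i * real (f i) \<le> K"
        using le insert.hyps g by (auto simp: A_def)
      hence "real (f i) \<le> K / u i" using ui by (simp add: field_simps)
      hence "f i \<le> X" by (simp add: X_def le_nat_floor)
      moreover have "f = g(i := f i)" by (auto simp: g_def)
      ultimately show "f \<in> (\<Union>t\<le>X. (\<lambda>g. g(i := t)) ` A (K - u i * real t))"
        using gA by blast
    qed
    moreover have fin: "finite (\<Union>t\<le>X. (\<lambda>g. g(i := t)) ` A (K - u i * real t))"
      using IH by auto
    ultimately have finA': "finite A'" and "card A' \<le> card (\<Union>t\<le>X. (\<lambda>g. g(i := t)) ` A (K - u i * real t))"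
      by (auto intro: finite_subset card_mono)
    note this(2)
    also have "card (\<Union>t\<le>X. (\<lambda>g. g(i := t)) ` A (K - u i * real t))
        \<le> (\<Sum>t\<le>X. card ((\<lambda>g. g(i := t)) ` A (K - u i * real t)))"
      by (rule card_UN_le) simp
    also have "\<dots> \<le> (\<Sum>t\<le>X. card (A (K - u i * real t)))"
      by (intro sum_mono card_image_le IH)
    finally have "real (card A') \<le> (\<Sum>t\<le>X. real (card (A (K - u i * real t))))"
      by (simp flip: of_nat_sum)
    also have "\<dots> \<le> (\<Sum>t\<le>X. max 0 ((K + ?U) - u i * real t) ^ card S / C)"
    proof (intro sum_mono)
      fix t
      show "real (card (A (K - u i * real t))) \<le> max 0 ((K + ?U) - u i * real t) ^ card S / C"
        using IH(2)[of "K - u i * real t"] by (simp add: algebra_simps)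
    qed
    also have "\<dots> = (\<Sum>t\<le>X. max 0 ((K + ?U) - u i * real t) ^ card S) / C"
      by (simp add: sum_divide_distrib)
    also have "\<dots> \<le> (max 0 ((K + ?U) + u i) ^ Suc (card S) / (real (Suc (card S)) * u i)) / C"
    proof (intro divide_right_mono sum_pos_part_power_le disjI2 ui)
      have "u i * real X \<le> K" using X ui by (simp add: field_simps)
      thus "u i * real X \<le> K + ?U" using U0 by linarith
    qed (use C0 in simp)
    finally show ?thesis using finA' by (simp add: algebra_simps)
  qed
  thus ?case unfolding A'_def[symmetric] C_def using insert.hyps
    by (simp add: algebra_simps)
qed

section \<open>Probability of prescribed counts on a set of vertices\<close>

lemma card_multisets_of_size_mono:
  assumes "finite A" "A \<noteq> {}" "j \<le> k"
  shows "card (multisets_of_size A j) \<le> card (multisets_of_size A k)"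
proof -
  obtain m where m: "card A = Suc m" using assms by (cases "card A") auto
  have "m + j choose j = m + j choose m" "m + k choose k = m + k choose m"
    using binomial_symmetric[of j "m + j"] binomial_symmetric[of k "m + k"] by auto
  moreover have "m + j choose m \<le> m + k choose m" using assms(3) by (intro binomial_right_mono) auto
  ultimately show ?thesis using assms m by (simp add: card_multisets_of_size)
qed

text \<open>A multiset is determined by its counts on \<open>S\<close> and its part outside
  \<open>S\<close>. The latter has at most \<open>k\<close> elements, all from the nonempty
  \<open>V - S\<close>, and by monotonicity it is counted as if it had exactly
  \<open>k\<close>.\<close>

lemma card_multisets_restrict_le:
  assumes V: "finite V" and S: "S \<subset> V" and A: "finite A"
  shows "card {D \<in> multisets_of_size V k. restrict (count D) S \<in> A}
       \<le> card A * card (multisets_of_size (V - S) k)"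
proof -
  let ?L = "{D \<in> multisets_of_size V k. restrict (count D) S \<in> A}"
  let ?\<phi> = "\<lambda>D. (restrict (count D) S, filter_mset (\<lambda>w. w \<notin> S) D)"
  let ?M = "\<lambda>a. multisets_of_size (V - S) (k - (\<Sum>w\<in>S. a w))"
  have finS: "finite S" using S V by (auto intro: finite_subset)
  have "inj_on ?\<phi> ?L"
  proof (rule inj_onI)
    fix D D' assume "?\<phi> D = ?\<phi> D'"
    hence 1: "restrict (count D) S = restrict (count D') S"
      and 2: "filter_mset (\<lambda>w. w \<notin> S) D = filter_mset (\<lambda>w. w \<notin> S) D'" by auto
    have "count D w = count D' w" for w
    proof (cases "w \<in> S")
      case True thus ?thesis using fun_cong[OF 1, of w] by simp
    next
      case False thus ?thesis using arg_cong[OF 2, of "\<lambda>M. count M w"] by simp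
    qed
    thus "D = D'" by (simp add: multiset_eq_iff)
  qed
  moreover have "?\<phi> ` ?L \<subseteq> (SIGMA a:A. ?M a)"
  proof safe
    fix D assume D: "D \<in> multisets_of_size V k"
    have "size (filter_mset (\<lambda>w. w \<in> S) D) = (\<Sum>w\<in>S. count D w)"
    proof -
      have "size (filter_mset (\<lambda>w. w \<in> S) D) = (\<Sum>w\<in>set_mset (filter_mset (\<lambda>w. w \<in> S) D). count (filter_mset (\<lambda>w. w \<in> S) D) w)"
        by (simp add: size_multiset_overloaded_eq)
      also have "\<dots> = (\<Sum>w\<in>S. count (filter_mset (\<lambda>w. w \<in> S) D) w)"
        using finS by (intro sum.mono_neutral_left) (auto simp: not_in_iff)
      finally show ?thesis by simp
    qed
    moreover have "size D = size (filter_mset (\<lambda>w. w \<in> S) D) + size (filter_mset (\<lambda>w. w \<notin> S) D)"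
      using multiset_partition[of D "\<lambda>w. w \<in> S"] by (metis size_union)
    ultimately show "filter_mset (\<lambda>w. w \<notin> S) D \<in> ?M (restrict (count D) S)"
      using D by (auto simp: multisets_of_size_def)
  qed
  moreover have "finite (SIGMA a:A. ?M a)"
    using A V by (intro finite_SigmaI) (auto intro: finite_multisets_of_size)
  ultimately have "card ?L \<le> card (SIGMA a:A. ?M a)"
    by (rule card_inj_on_le)
  also have "\<dots> = (\<Sum>a\<in>A. card (?M a))"
    using A V by (intro card_SigmaI) (auto intro: finite_multisets_of_size)
  also have "\<dots> \<le> (\<Sum>a\<in>A. card (multisets_of_size (V - S) k))"
    using V S by (intro sum_mono card_multisets_of_size_mono) auto
  finally show ?thesis by simp
qed

text \<open>Going from \<open>N'\<close> to \<open>N' - 1\<close> vertices multiplies the number of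
  multisets by \<open>(N' - 1) / (N' - 1 + k)\<close>, which is at most \<open>N / (N + k)\<close>
  for \<open>N' \<le> N\<close>.\<close>

lemma choose_multiset_ratio:
  assumes "M < N"
  shows "real ((N - M) + k - 1 choose k) \<le> real (N + k - 1 choose k) * (real N / real (N + k)) ^ M"
  using assms
proof (induction M)
  case (Suc M)
  define m where "m = N - Suc M - 1"
  have m: "N - Suc M = Suc m" "N - M = Suc (Suc m)" "m + 1 < N" using Suc.prems by (auto simp: m_def)
  have "(Suc m + k choose k) * Suc m = (m + k choose k) * (Suc m + k)"
    using Suc_times_binomial_eq[of "m + k" m] binomial_symmetric[of k "m + k"] binomial_symmetric[of k "Suc m + k"]
    by (simp add: mult.commute del: binomial_Suc_Suc)
  hence "real ((Suc m + k choose k) * Suc m) = real ((m + k choose k) * (Suc m + k))" by (rule arg_cong)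
  hence "real (m + k choose k) = real (Suc m + k choose k) * (real (Suc m) / real (Suc m + k))"
    unfolding of_nat_mult by (simp add: field_simps)
  also have "\<dots> \<le> real (Suc m + k choose k) * (real N / real (N + k))"
  proof (intro mult_left_mono)
    have "real (Suc m) * real k \<le> real N * real k" using m by (intro mult_right_mono) auto
    thus "real (Suc m) / real (Suc m + k) \<le> real N / real (N + k)"
      using m by (simp add: divide_simps) (simp add: algebra_simps)
  qed auto
  also have "\<dots> \<le> real (N + k - 1 choose k) * (real N / real (N + k)) ^ M * (real N / real (N + k))"
    using Suc m by (intro mult_right_mono) auto
  finally show ?case unfolding m by (simp add: mult_ac)
qed simp

lemma prob_multisets:
  assumes "finite V" "V \<noteq> {}"
  shows "measure_pmf.prob (pmf_of_set (multisets_of_size V k)) {D. P D}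
       = real (card {D \<in> multisets_of_size V k. P D}) / real (card (multisets_of_size V k))"
    and "card (multisets_of_size V k) > 0"
proof -
  obtain m where m: "card V = Suc m" using assms by (cases "card V") auto
  thus pos: "card (multisets_of_size V k) > 0"
    using assms by (simp add: card_multisets_of_size zero_less_binomial)
  hence "multisets_of_size V k \<noteq> {}" by auto
  thus "measure_pmf.prob (pmf_of_set (multisets_of_size V k)) {D. P D}
       = real (card {D \<in> multisets_of_size V k. P D}) / real (card (multisets_of_size V k))"
    using assms by (subst measure_pmf_of_set) (auto simp: finite_multisets_of_size Collect_conj_eq)
qed

text \<open>With \<open>N = card V\<close>, each pattern of counts on \<open>S\<close> has at most
  the probability that independent geometric counts of mean \<open>k / N\<close> give to the
  all-zero pattern. No factor polynomial in \<open>N\<close> is lost, as the union bound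
  demands.\<close>

lemma prob_restrict_le:
  assumes V: "finite V" and S: "S \<subset> V" and A: "finite A"
  shows "measure_pmf.prob (pmf_of_set (multisets_of_size V k)) {D. restrict (count D) S \<in> A}
       \<le> real (card A) * (real (card V) / real (card V + k)) ^ card S"
proof -
  have ne: "V \<noteq> {}" using S by auto
  have finS: "finite S" using S V by (auto intro: finite_subset)
  have cS: "card S < card V" using S V by (rule psubset_card_mono[rotated])
  have "real (card {D \<in> multisets_of_size V k. restrict (count D) S \<in> A})
      \<le> real (card A) * real (card (multisets_of_size (V - S) k))"
    using card_multisets_restrict_le[OF assms, of k] by (simp flip: of_nat_mult)
  also have "\<dots> = real (card A) * real ((card V - card S) + k - 1 choose k)"
    using V S finS by (subst card_multisets_of_size) (auto simp: card_Diff_subset)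
  also have "\<dots> \<le> real (card A) * (real (card V + k - 1 choose k) * (real (card V) / real (card V + k)) ^ card S)"
    by (intro mult_left_mono choose_multiset_ratio cS) auto
  also have "real (card V + k - 1 choose k) = real (card (multisets_of_size V k))"
    using V by (simp add: card_multisets_of_size)
  finally show ?thesis
    using prob_multisets(2)[OF V ne, of k] unfolding prob_multisets(1)[OF V ne]
    by (subst pos_divide_le_eq) (simp_all only: of_nat_0_less_iff mult_ac)
qed

text \<open>\<open>real M ^ M / fact M\<close> is one term of the series of
  \<open>exp (real M)\<close>.\<close>

lemma power_self_le_exp_fact: "real M ^ M \<le> exp (real M) * fact M"
proof (cases "M = 0")
  case False
  have "(\<Sum>n\<in>{M}. real M ^ n /\<^sub>R fact n) \<le> (\<Sum>n. real M ^ n /\<^sub>R fact n)"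
    by (intro sum_le_suminf summable_exp_generic) auto
  hence "real M ^ M / fact M \<le> exp (real M)" by (simp add: exp_def divide_inverse mult.commute)
  thus ?thesis by (simp add: divide_simps)
qed simp

text \<open>Lattice points of a simplex times the bound for a single pattern;
  \<open>exp 1 / real (card S)\<close> comes from the factorial and \<open>1 / c\<close> from
  \<open>N / (N + k)\<close>. The product form over \<open>S\<close> lets each vertex be compared
  with its own term of the exponent.\<close>

lemma prob_weighted_sum_le:
  fixes u :: "'v \<Rightarrow> real"
  assumes V: "finite V" and S: "S \<subset> V" "S \<noteq> {}" and u: "\<And>w. w \<in> S \<Longrightarrow> 0 < u w" and K: "0 \<le> K"
    and U: "(\<Sum>w\<in>S. u w) \<le> U" and c: "0 < c" "c * real (card V) \<le> real k"
  shows "measure_pmf.prob (pmf_of_set (multisets_of_size V k)) {D. (\<Sum>w\<in>S. u w * real (count D w)) \<le> K}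
       \<le> (\<Prod>w\<in>S. exp 1 * (K + U) / (real (card S) * c * u w))"
proof -
  let ?M = "card S" and ?N = "real (card V)"
  have finS: "finite S" using S V by (auto intro: finite_subset)
  have M: "0 < ?M" using S finS by (simp add: card_gt_0_iff)
  have N: "0 < ?N" using S V by (auto simp: card_gt_0_iff)
  define A where "A = {f \<in> S \<rightarrow>\<^sub>E (UNIV :: nat set). (\<Sum>w\<in>S. u w * real (f w)) \<le> K}"
  have P0: "0 < (\<Prod>w\<in>S. u w)" using u by (intro prod_pos) auto
  have U0: "0 \<le> (\<Sum>w\<in>S. u w)" using u by (intro sum_nonneg) (auto intro: less_imp_le)
  have A: "finite A" "real (card A) \<le> max 0 (K + (\<Sum>w\<in>S. u w)) ^ ?M / (fact ?M * (\<Prod>w\<in>S. u w))"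
    using card_simplex_le[OF finS u, where K = K] by (auto simp: A_def)
  have "real (card A) \<le> (K + U) ^ ?M / (fact ?M * (\<Prod>w\<in>S. u w))"
    using A(2) K U U0 P0 by (elim order.trans) (intro divide_right_mono power_mono; simp)
  also have "\<dots> \<le> (K + U) ^ ?M * (exp 1 / real ?M) ^ ?M / (\<Prod>w\<in>S. u w)"
  proof -
    have "1 / fact ?M \<le> (exp 1 / real ?M) ^ ?M"
      using power_self_le_exp_fact[of ?M] M by (simp add: field_simps flip: exp_of_nat_mult)
    hence "(K + U) ^ ?M * (1 / fact ?M) / (\<Prod>w\<in>S. u w) \<le> (K + U) ^ ?M * (exp 1 / real ?M) ^ ?M / (\<Prod>w\<in>S. u w)"
      using K U U0 P0 by (intro divide_right_mono mult_left_mono) auto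
    thus ?thesis by simp
  qed
  finally have cA: "real (card A) \<le> (K + U) ^ ?M * (exp 1 / real ?M) ^ ?M / (\<Prod>w\<in>S. u w)" .
  have r: "?N / real (card V + k) \<le> 1 / c"
    using c N by (simp add: divide_simps) (simp add: algebra_simps)
  have "{D. (\<Sum>w\<in>S. u w * real (count D w)) \<le> K} = {D. restrict (count D) S \<in> A}"
    by (auto simp: A_def)
  hence "measure_pmf.prob (pmf_of_set (multisets_of_size V k)) {D. (\<Sum>w\<in>S. u w * real (count D w)) \<le> K}
      \<le> real (card A) * (?N / real (card V + k)) ^ ?M"
    using prob_restrict_le[OF V S(1) A(1), of k] by simp
  also have "\<dots> \<le> ((K + U) ^ ?M * (exp 1 / real ?M) ^ ?M / (\<Prod>w\<in>S. u w)) * (1 / c) ^ ?M"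
    using cA r c N K U U0 P0
    by (intro mult_mono power_mono divide_nonneg_nonneg mult_nonneg_nonneg) auto
  also have "\<dots> = (\<Prod>w\<in>S. exp 1 * (K + U) / (real (card S) * c * u w))"
    by (simp add: prod_dividef power_mult_distrib power_divide prod.distrib mult_ac)
  finally show ?thesis .
qed

section \<open>Comparison with independent geometric variables\<close>

text \<open>These are the terms of \<open>(k + (n - k)) ^ n\<close>. The ratio of the terms at
  \<open>j + 1\<close> and \<open>j\<close> is \<open>(n - j) * k / ((j + 1) * (n - k))\<close>, at
  least 1 for \<open>j < k\<close> and at most 1 from \<open>k\<close> on.\<close>

lemma binomial_weight_le_mode:
  fixes n k :: nat
  assumes "k < n" "j \<le> n"
  shows "(n choose j) * k ^ j * (n - k) ^ (n - j) \<le> (n choose k) * k ^ k * (n - k) ^ (n - k)"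
proof -
  define t where "t j = (n choose j) * k ^ j * (n - k) ^ (n - j)" for j
  have t_Suc: "t j * ((n - j) * k) = t (Suc j) * (Suc j * (n - k))" if "j < n" for j
  proof -
    have "(n - k) ^ (n - j) = (n - k) * (n - k) ^ (n - Suc j)"
      using that by (metis Suc_diff_Suc power_Suc)
    moreover have "(n choose Suc j) * Suc j = (n choose j) * (n - j)"
      using binomial_absorb_comp[of n j] binomial_absorption[of j n] by (simp add: mult.commute)
    ultimately have *: "(n - k) ^ (n - j) = (n - k) * (n - k) ^ (n - Suc j)"
      "(n choose j) * (n - j) = (n choose Suc j) * Suc j" by auto
    have "t j * ((n - j) * k) = ((n choose j) * (n - j)) * (k ^ j * k) * (n - k) ^ (n - j)"
      by (simp only: t_def mult_ac)
    also have "\<dots> = ((n choose Suc j) * Suc j) * (k ^ j * k) * ((n - k) * (n - k) ^ (n - Suc j))"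
      by (simp only: *)
    also have "\<dots> = t (Suc j) * (Suc j * (n - k))"
      by (simp only: t_def mult_ac power_Suc)
    finally show ?thesis .
  qed
  show ?thesis
  proof (cases "j \<le> k")
    case True
    hence "t j \<le> t k"
    proof (induction rule: inc_induct)
      case (step i)
      have "t i * (Suc i * (n - k)) \<le> t i * ((n - i) * k)"
        using step.hyps assms mult_le_mono[of "Suc i" k "n - k" "n - i"]
        by (intro mult_left_mono) (simp_all add: mult.commute[of k])
      also have "\<dots> = t (Suc i) * (Suc i * (n - k))"
        using step.hyps assms by (intro t_Suc) auto
      finally have "t i \<le> t (Suc i)" using assms by simp
      with step.IH show ?case by simp
    qed simp
    thus ?thesis by (simp add: t_def)
  next
    case False
    hence "k \<le> j" by simp
    hence "t j \<le> t k" using assms(2)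
    proof (induction rule: dec_induct)
      case (step i)
      have "t (Suc i) * (Suc i * (n - k)) = t i * ((n - i) * k)"
        using step.prems by (intro t_Suc[symmetric]) auto
      also have "\<dots> \<le> t i * (Suc i * (n - k))"
        using step.hyps assms mult_le_mono[of "n - i" "n - k" k "Suc i"]
        by (intro mult_left_mono) (simp_all add: mult.commute[of "n - k"])
      finally have "t (Suc i) \<le> t i" using assms by simp
      with step.IH step.prems show ?case by simp
    qed simp
    thus ?thesis by (simp add: t_def)
  qed
qed

lemma power_le_Suc_times_binomial_mode:
  fixes n k :: nat
  assumes "k < n"
  shows "n ^ n \<le> Suc n * ((n choose k) * k ^ k * (n - k) ^ (n - k))"
proof -
  have "n ^ n = (k + (n - k)) ^ n" using assms by simp
  also have "\<dots> = (\<Sum>j\<le>n. (n choose j) * k ^ j * (n - k) ^ (n - j))"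
    using binomial[of k "n - k" n] by simp
  also have "\<dots> \<le> (\<Sum>j\<le>n. (n choose k) * k ^ k * (n - k) ^ (n - k))"
    using assms by (intro sum_mono binomial_weight_le_mode) auto
  finally show ?thesis by simp
qed

text \<open>The second factor is the probability that \<open>N\<close> independent geometric variables of mean
  \<open>k / N\<close> sum up to \<open>k\<close>.\<close>

lemma negative_binomial_mode_ge:
  fixes k N :: nat
  assumes N: "0 < N"
  defines "r \<equiv> real k / real (N + k)"
  shows "1 \<le> (real (N + k) + 1)\<^sup>2 * (real (N + k - 1 choose k) * r ^ k * (1 - r) ^ N)"
proof -
  let ?n = "N + k"
  have rN: "1 - r = real N / real ?n" using N by (simp add: r_def field_simps)
  obtain m where m: "N = Suc m" using N by (cases N) auto
  have "N * (?n choose k) = ?n * (?n - 1 choose k)"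
    using Suc_times_binomial_eq[of "m + k" m] binomial_symmetric[of k "m + k"] binomial_symmetric[of k "Suc m + k"]
    by (simp add: m mult.commute del: binomial_Suc_Suc)
  hence c: "real N * real (?n choose k) = real ?n * real (?n - 1 choose k)"
    by (metis of_nat_mult)
  have "real (?n ^ ?n) \<le> real (Suc ?n * ((?n choose k) * k ^ k * N ^ N))"
    unfolding of_nat_le_iff using power_le_Suc_times_binomial_mode[of k ?n] N by simp
  hence "real ?n ^ ?n \<le> (real ?n + 1) * real (?n choose k) * (real k ^ k * real N ^ N)"
    by (simp only: of_nat_power of_nat_mult of_nat_Suc mult_ac add_ac)
  \<comment> \<open>The first factor \<open>real ?n + 1\<close> is the number of terms of the
    binomial expansion; this second one pays for passing from \<open>?n choose k\<close> to the
    number \<open>?n - 1 choose k\<close> of multisets.\<close>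
  also have "real (?n choose k) \<le> (real ?n + 1) * real (?n - 1 choose k)"
  proof -
    have "1 * real (?n choose k) \<le> real N * real (?n choose k)"
      using N by (intro mult_right_mono) auto
    also have "\<dots> \<le> (real ?n + 1) * real (?n - 1 choose k)"
      unfolding c by (intro mult_right_mono) auto
    finally show ?thesis by simp
  qed
  finally have "real ?n ^ ?n \<le> (real ?n + 1)\<^sup>2 * (real (?n - 1 choose k) * real k ^ k * real N ^ N)"
    by (simp add: power2_eq_square mult.assoc mult_left_mono mult_right_mono)
  moreover have "0 < real ?n ^ ?n" using N by simp
  ultimately have "1 \<le> (real ?n + 1)\<^sup>2 * (real (?n - 1 choose k) * real k ^ k * real N ^ N) / real ?n ^ ?n"
    by (subst pos_le_divide_eq) simp_all
  also have "\<dots> = (real ?n + 1)\<^sup>2 * (real (?n - 1 choose k) * r ^ k * (1 - r) ^ N)"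
    unfolding rN unfolding r_def by (simp add: power_divide power_add mult_ac)
  finally show ?thesis .
qed

text \<open>Under independent geometric counts all multisets of size \<open>k\<close> are equally
  likely, so the uniform distribution is the product measure conditioned on the total
  \<open>k\<close>. The prefactor bounds the inverse probability of that condition.\<close>

lemma prob_multisets_le_geometric:
  fixes V :: "'v set" and k :: nat
  assumes V: "finite V" "V \<noteq> {}" and PQ: "\<And>D. D \<in> multisets_of_size V k \<Longrightarrow> P D \<Longrightarrow> Q (count D)"
  defines "r \<equiv> real k / real (card V + k)"
  shows "measure_pmf.prob (pmf_of_set (multisets_of_size V k)) {D. P D}
       \<le> (real (card V + k) + 1)\<^sup>2 * measure_pmf.prob (Pi_pmf V 0 (\<lambda>_. geometric_pmf (1 - r))) {f. Q f}"
proof -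
  let ?N = "card V" and ?G = "Pi_pmf V 0 (\<lambda>_. geometric_pmf (1 - r))"
  let ?L = "{D \<in> multisets_of_size V k. P D}" and ?C = "real (card (multisets_of_size V k))"
  have N: "0 < ?N" using V by (simp add: card_gt_0_iff)
  have r: "0 \<le> r" "r < 1" using N by (auto simp: r_def divide_simps)
  have finL: "finite ?L" using V by (simp add: finite_multisets_of_size)
  have inj: "inj_on count ?L" by (simp add: inj_on_def count_inject)
  have pm: "pmf ?G (count D) = r ^ k * (1 - r) ^ ?N" if "D \<in> ?L" for D
  proof -
    have D: "set_mset D \<subseteq> V" "size D = k" using that by (auto simp: multisets_of_size_def)
    have "(\<Sum>x\<in>V. count D x) = k"
      unfolding D(2)[symmetric] size_multiset_overloaded_eq
      using D(1) V by (intro sum.mono_neutral_right) (auto simp: not_in_iff)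
    moreover have "pmf ?G (count D) = (\<Prod>x\<in>V. r ^ count D x * (1 - r))"
      using D r V by (subst pmf_Pi) (auto simp: not_in_iff)
    ultimately show ?thesis
      by (simp add: prod.distrib flip: power_sum)
  qed
  have "real (card ?L) * (r ^ k * (1 - r) ^ ?N) = (\<Sum>D\<in>?L. pmf ?G (count D))"
    using pm by simp
  also have "\<dots> = (\<Sum>f\<in>count ` ?L. pmf ?G f)"
    by (simp add: sum.reindex[OF inj])
  also have "\<dots> = measure_pmf.prob ?G (count ` ?L)"
    using finL by (subst measure_measure_pmf_finite) auto
  also have "\<dots> \<le> measure_pmf.prob ?G {f. Q f}"
    using PQ by (intro measure_pmf.finite_measure_mono) auto
  finally have le: "real (card ?L) * (r ^ k * (1 - r) ^ ?N) \<le> measure_pmf.prob ?G {f. Q f}" .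
  have C0: "0 < ?C" using prob_multisets(2)[OF V] by simp
  have "1 \<le> (real (?N + k) + 1)\<^sup>2 * (?C * r ^ k * (1 - r) ^ ?N)"
    using negative_binomial_mode_ge[OF N, of k] V by (simp add: card_multisets_of_size r_def)
  hence "real (card ?L) / ?C * 1 \<le> real (card ?L) / ?C * ((real (?N + k) + 1)\<^sup>2 * (?C * r ^ k * (1 - r) ^ ?N))"
    by (intro mult_left_mono) auto
  also have "\<dots> = (real (?N + k) + 1)\<^sup>2 * (real (card ?L) * (r ^ k * (1 - r) ^ ?N))"
    using C0 by (simp add: field_simps)
  also have "\<dots> \<le> (real (?N + k) + 1)\<^sup>2 * measure_pmf.prob ?G {f. Q f}"
    by (intro mult_left_mono le) auto
  finally show ?thesis unfolding prob_multisets(1)[OF V] by simp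
qed

section \<open>Independence on disjoint blocks\<close>

lemma prob_pair_pmf_Times:
  "measure_pmf.prob (pair_pmf M N) (A \<times> B) = measure_pmf.prob M A * measure_pmf.prob N B"
proof -
  have "measure_pmf.prob (pair_pmf M N) (A \<times> B)
      = measure_pmf.prob (pair_pmf M N) ((A \<times> B) \<inter> set_pmf (pair_pmf M N))"
    by (rule measure_Int_set_pmf[symmetric])
  also have "(A \<times> B) \<inter> set_pmf (pair_pmf M N) = (A \<inter> set_pmf M) \<times> (B \<inter> set_pmf N)"
    by auto
  also have "measure_pmf.prob (pair_pmf M N) \<dots>
      = measure_pmf.prob M (A \<inter> set_pmf M) * measure_pmf.prob N (B \<inter> set_pmf N)"
    by (rule measure_pmf_prob_product) (auto intro: countable_subset[OF _ countable_set_pmf])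
  finally show ?thesis by (simp add: measure_Int_set_pmf)
qed

text \<open>Events on disjoint sets of coordinates are independent. Splitting off one block leaves
  the product measure on \<open>V - B j\<close>, hence the induction with arbitrary
  \<open>V\<close>.\<close>

lemma prob_Pi_pmf_no_cylinder:
  fixes p :: "'v \<Rightarrow> 'b pmf"
  assumes "finite J" "finite V" "\<And>j. j \<in> J \<Longrightarrow> B j \<subseteq> V" "disjoint_family_on B J"
  shows "measure_pmf.prob (Pi_pmf V dflt p) {f. \<forall>j\<in>J. f \<notin> Pi (B j) (M j)}
       = (\<Prod>j\<in>J. 1 - (\<Prod>w\<in>B j. measure_pmf.prob (p w) (M j w)))"
  using assms
proof (induction arbitrary: V rule: finite_induct)
  case (insert j J)
  let ?A = "B j" and ?R = "V - B j"
  have V: "V = ?A \<union> ?R" using insert.prems(2)[of j] by auto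
  have fin: "finite ?A" "finite ?R" using insert.prems by (auto intro: finite_subset)
  have disj: "B i \<inter> ?A = {}" if "i \<in> J" for i
    using insert.hyps that by (intro disjoint_family_onD[OF insert.prems(3)]) auto
  let ?h = "\<lambda>(f, g) x. if x \<in> ?A then f x else g x"
  have vim: "?h -` {f. \<forall>j\<in>insert j J. f \<notin> Pi (B j) (M j)}
      = {f. f \<notin> Pi ?A (M j)} \<times> {g. \<forall>j\<in>J. g \<notin> Pi (B j) (M j)}"
  proof -
    have 1: "?h (f, g) \<in> Pi ?A (M j) \<longleftrightarrow> f \<in> Pi ?A (M j)" for f g
      by (auto simp: Pi_def)
    have 2: "?h (f, g) \<in> Pi (B i) (M i) \<longleftrightarrow> g \<in> Pi (B i) (M i)" if "i \<in> J" for f g i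
      using disj[OF that] by (auto simp: Pi_def)
    show ?thesis
    proof (intro set_eqI)
      fix x :: "('v \<Rightarrow> 'b) \<times> ('v \<Rightarrow> 'b)"
      obtain f g where x: "x = (f, g)" by (cases x)
      show "x \<in> ?h -` {f. \<forall>j\<in>insert j J. f \<notin> Pi (B j) (M j)} \<longleftrightarrow>
        x \<in> {f. f \<notin> Pi ?A (M j)} \<times> {g. \<forall>j\<in>J. g \<notin> Pi (B j) (M j)}"
      proof -
        have "(\<forall>i\<in>insert j J. ?h (f, g) \<notin> Pi (B i) (M i))
          \<longleftrightarrow> ?h (f, g) \<notin> Pi ?A (M j) \<and> (\<forall>i\<in>J. ?h (f, g) \<notin> Pi (B i) (M i))"
          by blast
        also have "\<dots> \<longleftrightarrow> f \<notin> Pi ?A (M j) \<and> (\<forall>i\<in>J. g \<notin> Pi (B i) (M i))"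
          unfolding 1 by (simp only: 2 cong: ball_cong)
        finally show ?thesis
          unfolding x vimage_eq mem_Collect_eq mem_Times_iff fst_conv snd_conv .
      qed
    qed
  qed
  have "measure_pmf.prob (Pi_pmf V dflt p) {f. \<forall>j\<in>insert j J. f \<notin> Pi (B j) (M j)}
      = measure_pmf.prob (map_pmf ?h (pair_pmf (Pi_pmf ?A dflt p) (Pi_pmf ?R dflt p)))
          {f. \<forall>j\<in>insert j J. f \<notin> Pi (B j) (M j)}"
    using Pi_pmf_union[OF fin Diff_disjoint, of dflt p] unfolding V[symmetric] by (rule arg_cong)
  also have "\<dots> = measure_pmf.prob (Pi_pmf ?A dflt p) {f. f \<notin> Pi ?A (M j)}
      * measure_pmf.prob (Pi_pmf ?R dflt p) {g. \<forall>j\<in>J. g \<notin> Pi (B j) (M j)}"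
    unfolding measure_map_pmf vim prob_pair_pmf_Times ..
  also have "measure_pmf.prob (Pi_pmf ?A dflt p) {f. f \<notin> Pi ?A (M j)}
      = 1 - measure_pmf.prob (Pi_pmf ?A dflt p) (Pi ?A (M j))"
    using measure_pmf.prob_compl[of "Pi ?A (M j)" "Pi_pmf ?A dflt p"]
    by (simp add: Compl_eq flip: Compl_eq_Diff_UNIV)
  also have "measure_pmf.prob (Pi_pmf ?A dflt p) (Pi ?A (M j)) = (\<Prod>w\<in>?A. measure_pmf.prob (p w) (M j w))"
    by (rule measure_Pi_pmf_Pi) (use fin in simp)
  also have "measure_pmf.prob (Pi_pmf ?R dflt p) {g. \<forall>j\<in>J. g \<notin> Pi (B j) (M j)}
      = (\<Prod>j\<in>J. 1 - (\<Prod>w\<in>B j. measure_pmf.prob (p w) (M j w)))"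
    using insert.prems disj by (intro insert.IH) (auto simp: disjoint_family_on_def)
  finally show ?case using insert.hyps by simp
qed simp

lemma prob_geometric_atMost:
  assumes "0 \<le> r" "r < 1"
  shows "measure_pmf.prob (geometric_pmf (1 - r)) {..m} = 1 - r ^ Suc m"
proof -
  have "measure_pmf.prob (geometric_pmf (1 - r)) {..m} = (\<Sum>i\<le>m. r ^ i * (1 - r))"
    using assms by (subst measure_measure_pmf_finite) auto
  also have "\<dots> = (1 - r) * (\<Sum>i<Suc m. r ^ i)"
    by (simp add: lessThan_Suc_atMost sum_distrib_left mult.commute)
  also have "\<dots> = 1 - r ^ Suc m"
    using assms by (subst sum_gp_strict) auto
  finally show ?thesis .
qed

section \<open>Probability of being unsolvable\<close>

text \<open>If \<open>v\<close> cannot be reached, the potential is at most the constant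
  \<open>K\<close>, and so is its part from the ball \<open>S\<close> of radius \<open>l\<close>.
  The bound for such a weighted sum has the factor
  \<open>exp 1 * (K + U) * exp (lam w) / (card S * c)\<close> for each \<open>w\<close>, and
  \<open>big\<close> turns it into \<open>exp (- (l - lam w))\<close>; the exponents add up to the
  discrete simplex volume.\<close>

lemma prob_not_solvable_for_le:
  fixes d n h k :: nat and q :: "nat \<Rightarrow> nat" and l c :: real
  defines "s \<equiv> \<Sum>i=1..d. ln (real (q i))" and "P \<equiv> \<Prod>i=1..d. ln (real (q i))"
    and "U \<equiv> \<Prod>i=1..d. 2 * (1 + 1 / ln (real (q i)))"
  assumes d: "1 \<le> d" and q: "\<forall>i\<in>{1..d}. q i \<ge> 2" and v: "v \<in> grid d n"
    and h: "\<forall>i\<in>{1..d}. l < ln (real (q i)) * real h" and n: "2 * h + 1 \<le> n" and l: "s < l"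
    and c: "0 < c" "c * real n ^ d \<le> real k"
    and big: "exp 1 * (real (\<Sum>i=1..d. q i) * U + U) * exp l
               \<le> c * ((l - s) ^ Suc d / (fact (Suc d) * P) / l)"
  shows "measure_pmf.prob (pmf_of_set (multisets_of_size (grid d n) k))
           {D. \<not> solvable_for (pebbling_move d q n) v D}
       \<le> exp (- ((\<Prod>i=1..d. if deep n h (v i) then 2 else 1) * ((l - s) ^ Suc d / (fact (Suc d) * P))))"
proof -
  define a where "a i = ln (real (q i))" for i
  define lam where "lam w = log_dist d q v w" for w
  define S where "S = {w \<in> grid d n. lam w \<le> l}"
  define K where "K = real (\<Sum>i=1..d. q i) * U"
  define G where "G = (l - s) ^ Suc d / (fact (Suc d) * P)"
  let ?\<mu> = "pmf_of_set (multisets_of_size (grid d n) k)"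
  have a: "0 < a i" if "i \<in> {1..d}" for i using q that by (auto simp: a_def Ball_def)
  have vi: "v i \<in> {1..n}" if "i \<in> {1..d}" for i using v that by (auto simp: grid_def dest: PiE_mem)
  have s0: "0 \<le> s" unfolding s_def using a by (intro sum_nonneg) (auto simp: a_def intro: less_imp_le)
  have P0: "0 < P" unfolding P_def using a by (intro prod_pos) (auto simp: a_def)
  have U0: "0 < U" unfolding U_def using a by (intro prod_pos) (auto simp: a_def intro!: add_pos_pos)
  have G0: "0 < G" unfolding G_def using l P0 by simp
  have lam_v: "lam v = 0" by (simp add: lam_def)
  have S: "S \<noteq> {}" using v l s0 lam_v by (auto simp: S_def)
  have U: "(\<Sum>w\<in>grid d n. exp (- lam w)) \<le> U"
    using sum_exp_wdist_le[of "{1..d}" a v n 1] a vi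
    unfolding U_def lam_def grid_def a_def by simp
  have lower: "(\<Prod>i=1..d. if deep n h (v i) then 2 else 1) * G \<le> (\<Sum>w\<in>S. l - lam w)"
  proof -
    have "(\<Prod>i=1..d. if deep n h (v i) then 2 else 1) * G \<le> (\<Sum>w\<in>grid d n. max 0 (l - lam w))"
      using sum_pos_part_wdist_ge[of "{1..d}" a l h v n] a vi n h l
      unfolding G_def lam_def grid_def a_def s_def P_def by (simp add: less_imp_le)
    also have "\<dots> = (\<Sum>w\<in>S. max 0 (l - lam w))"
      by (intro sum.mono_neutral_right) (auto simp: S_def)
    also have "\<dots> = (\<Sum>w\<in>S. l - lam w)" by (intro sum.cong) (auto simp: S_def)
    finally show ?thesis .
  qed
  \<comment> \<open>\<open>h\<close> steps along coordinate 1 lead out of the ball, and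
    \<open>2 * h + 1 \<le> n\<close> leaves room for them in one direction.\<close>
  have SV: "S \<subset> grid d n"
  proof -
    obtain t where t: "t \<in> {1..n}" "real h \<le> \<bar>real t - real (v 1)\<bar>"
    proof (cases "v 1 \<le> h")
      case True
      show ?thesis by (rule that[of "v 1 + h"]) (use True n vi[of 1] d in auto)
    next
      case False
      show ?thesis by (rule that[of "v 1 - h"]) (use False vi[of 1] d in \<open>auto simp: of_nat_diff\<close>)
    qed
    define w where "w = v(1 := t)"
    have w: "w \<in> grid d n" using v t d unfolding grid_def w_def by (auto simp: PiE_iff extensional_def)
    have "l < a 1 * real h" using h d by (auto simp: a_def)
    also have "\<dots> \<le> a 1 * \<bar>real (w 1) - real (v 1)\<bar>" using t a[of 1] d by (simp add: w_def)
    also have "\<dots> \<le> lam w"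
      unfolding lam_def wdist_def a_def[symmetric]
      using d by (intro member_le_sum) (auto intro!: mult_nonneg_nonneg less_imp_le[OF a])
    finally have "w \<notin> S" by (simp add: S_def)
    with w show ?thesis by (auto simp: S_def)
  qed
  have finS: "finite S" by (simp add: S_def)
  \<comment> \<open>Each vertex of \<open>S\<close> contributes at most \<open>l\<close> to a sum of
    at least \<open>G\<close>. This bound of order \<open>l ^ d\<close> on the number of vertices
    sharing the budget is the source of the \<open>log log n\<close> term.\<close>
  have M: "G / l \<le> real (card S)"
  proof -
    have "1 \<le> (\<Prod>i=1..d. if deep n h (v i) then 2 else (1::real))" by (intro prod_ge_1) auto
    hence "1 * G \<le> (\<Prod>i=1..d. if deep n h (v i) then 2 else 1) * G" using G0 by (intro mult_right_mono) auto
    also note lower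
    also have "(\<Sum>w\<in>S. l - lam w) \<le> (\<Sum>w\<in>S. l)"
      by (intro sum_mono) (auto simp: lam_def intro!: wdist_nonneg less_imp_le[OF a[unfolded a_def]])
    finally show ?thesis using l s0 by (simp add: divide_simps mult.commute)
  qed
  have M0: "0 < card S" using S finS by (simp add: card_gt_0_iff)
  have K0: "0 \<le> K" unfolding K_def using U0 by (intro mult_nonneg_nonneg of_nat_0_le_iff) simp
  have "measure_pmf.prob ?\<mu> {D. \<not> solvable_for (pebbling_move d q n) v D}
      \<le> measure_pmf.prob ?\<mu> {D. (\<Sum>w\<in>S. exp (- lam w) * real (count D w)) \<le> K}"
  proof (rule measure_pmf.finite_measure_mono_AE)
    have ne: "multisets_of_size (grid d n) k \<noteq> {}"
      using prob_multisets(2)[of "grid d n" k] v by (metis card.empty finite_grid less_irrefl empty_iff)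
    show "AE D in ?\<mu>. D \<in> {D. \<not> solvable_for (pebbling_move d q n) v D} \<longrightarrow>
            D \<in> {D. (\<Sum>w\<in>S. exp (- lam w) * real (count D w)) \<le> K}"
    proof (rule AE_pmfI, intro impI)
      fix D assume "D \<in> set_pmf ?\<mu>" and ns: "D \<in> {D. \<not> solvable_for (pebbling_move d q n) v D}"
      hence D: "set_mset D \<subseteq> grid d n"
        using ne by (subst (asm) set_pmf_of_set) (auto simp: finite_multisets_of_size multisets_of_size_subset)
      have "(\<Sum>w\<in>S. exp (- lam w) * real (count D w)) \<le> (\<Sum>w\<in>grid d n. real (count D w) * exp (- lam w))"
        by (subst mult.commute, rule sum_mono2) (auto simp: S_def)
      also have "\<dots> = potential d q v D"
        by (simp add: potential_def lam_def sum_mset_eq_sum_count[OF finite_grid D])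
      also have "\<dots> \<le> real (\<Sum>i=1..d. q i) * (\<Sum>w\<in>grid d n. exp (- lam w))"
      proof (rule ccontr)
        assume "\<not> ?thesis"
        moreover have "\<forall>i\<in>{1..d}. q i \<le> (\<Sum>i=1..d. q i)" by (auto intro: member_le_sum)
        ultimately have "solvable_for (pebbling_move d q n) v D"
          by (intro solvable_for_if_potential_large[OF q v D]) (auto simp: lam_def not_le)
        with ns show False by simp
      qed
      also have "\<dots> \<le> K" unfolding K_def using U by (intro mult_left_mono of_nat_0_le_iff)
      finally show "D \<in> {D. (\<Sum>w\<in>S. exp (- lam w) * real (count D w)) \<le> K}" by simp
    qed
  qed auto
  also have "\<dots> \<le> (\<Prod>w\<in>S. exp 1 * (K + U) / (real (card S) * c * exp (- lam w)))"
  proof (rule prob_weighted_sum_le)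
    have "(\<Sum>w\<in>S. exp (- lam w)) \<le> (\<Sum>w\<in>grid d n. exp (- lam w))"
      by (intro sum_mono2) (auto simp: S_def)
    thus "(\<Sum>w\<in>S. exp (- lam w)) \<le> U" using U by simp
  qed (use SV S K0 c in \<open>auto simp: card_grid\<close>)
  also have "\<dots> \<le> (\<Prod>w\<in>S. exp (- (l - lam w)))"
  proof (intro prod_mono conjI)
    fix w
    show "0 \<le> exp 1 * (K + U) / (real (card S) * c * exp (- lam w))" using K0 U0 c by simp
    have "exp 1 * (K + U) * exp l \<le> c * (G / l)" using big by (simp add: K_def G_def)
    also have "\<dots> \<le> c * real (card S)" using M c by (intro mult_left_mono) auto
    finally have "exp 1 * (K + U) * exp l \<le> c * real (card S)" .
    hence "exp 1 * (K + U) / (real (card S) * c) \<le> exp (- l)"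
      using M0 c by (simp add: exp_minus field_simps)
    hence "exp 1 * (K + U) / (real (card S) * c) / exp (- lam w) \<le> exp (- l) / exp (- lam w)"
      by (intro divide_right_mono) auto
    thus "exp 1 * (K + U) / (real (card S) * c * exp (- lam w)) \<le> exp (- (l - lam w))"
      by (simp add: divide_divide_eq_left flip: exp_diff)
  qed
  also have "\<dots> = exp (- (\<Sum>w\<in>S. l - lam w))"
    using finS by (simp add: exp_sum flip: sum_negf)
  also have "\<dots> \<le> exp (- ((\<Prod>i=1..d. if deep n h (v i) then 2 else 1) * G))"
    using lower by simp
  finally show ?thesis by (simp add: G_def)
qed

text \<open>For \<open>j \<ge> 1\<close> this is \<open>2 ^ j \<ge> 2 * j\<close> together with the
  hypothesis on \<open>exp (- (2 * G))\<close>. For \<open>j = 0\<close>, near the corners,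
  \<open>exp (- G)\<close> is only the square root of that quantity, and
  \<open>1 / n \<le> \<epsilon>\<close> still secures the factor \<open>\<epsilon>\<close>.\<close>

lemma exp_neg_two_power_le:
  fixes G \<epsilon> :: real
  assumes n: "0 < n" and e: "0 < \<epsilon>" "\<epsilon> \<le> 1" "1 / real n \<le> \<epsilon>" and G: "exp (- (2 * G)) \<le> \<epsilon> / real n"
  shows "exp (- (2 ^ j * G)) \<le> \<epsilon> * (1 / real n) ^ j"
proof (cases j)
  case 0
  have "exp (- G) ^ 2 = exp (- (2 * G))" by (simp flip: exp_of_nat_mult)
  also have "\<dots> \<le> \<epsilon> * (1 / real n)" using G by simp
  also have "\<dots> \<le> \<epsilon> ^ 2" using e mult_left_mono[OF e(3), of \<epsilon>] by (simp add: power2_eq_square)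
  finally have "exp (- G) \<le> \<epsilon>" using e by (meson power2_le_imp_le less_imp_le)
  thus ?thesis using 0 by simp
next
  case (Suc i)
  have "exp (- (2 * G)) \<le> \<epsilon> / real n" by (rule G)
  also have "\<dots> \<le> 1" using e n by (simp add: divide_simps)
  finally have G0: "0 \<le> G" by simp
  have "j \<le> 2 ^ i" unfolding Suc by (simp add: Suc_leI)
  hence "2 * real j \<le> 2 * real (2 ^ i)" by simp
  hence "2 * real j * G \<le> 2 ^ j * G" using G0 Suc by (intro mult_right_mono) auto
  hence "exp (- (2 ^ j * G)) \<le> exp (- (2 * G)) ^ j"
    by (simp add: mult_ac flip: exp_of_nat_mult)
  also have "\<dots> \<le> (\<epsilon> / real n) ^ j" using G by (intro power_mono) auto
  also have "\<dots> = \<epsilon> ^ j * (1 / real n) ^ j" by (simp add: power_divide)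
  also have "\<dots> \<le> \<epsilon> * (1 / real n) ^ j"
  proof (intro mult_right_mono)
    have "\<epsilon> ^ j \<le> \<epsilon> ^ 1" using e Suc by (intro power_decreasing) auto
    thus "\<epsilon> ^ j \<le> \<epsilon>" by simp
  qed simp
  finally show ?thesis .
qed

text \<open>The deep values contribute at most 1 in total, and the others, at most
  \<open>2 * h\<close> many, contribute 1 each.\<close>

lemma sum_deep_le:
  assumes "0 < n"
  shows "(\<Sum>t=1..n. if deep n h t then 1 / real n else 1) \<le> real (2 * h + 1)"
proof -
  have "(\<Sum>t=1..n. if deep n h t then 1 / real n else 1)
      \<le> (\<Sum>t=1..n. 1 / real n + (if t \<in> {1..h} \<union> {n - h<..n} then 1 else 0))"
    by (intro sum_mono) (auto simp: deep_def)
  also have "\<dots> = 1 + (\<Sum>t=1..n. if t \<in> {1..h} \<union> {n - h<..n} then 1 else 0)"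
    using assms by (simp add: sum.distrib)
  also have "(\<Sum>t=1..n. if t \<in> {1..h} \<union> {n - h<..n} then 1 else 0)
      = real (card ({1..n} \<inter> ({1..h} \<union> {n - h<..n})))"
    by (subst sum.inter_restrict[symmetric]) auto
  also have "card ({1..n} \<inter> ({1..h} \<union> {n - h<..n})) \<le> card ({1..h} \<union> {n - h<..n})"
    by (intro card_mono) auto
  also have "\<dots> \<le> card {1..h} + card {n - h<..n}" by (rule card_Un_le)
  also have "\<dots> \<le> 2 * h" by simp
  finally show ?thesis by simp
qed

lemma prob_not_solvable_le:
  fixes d n h k :: nat and q :: "nat \<Rightarrow> nat" and l c \<epsilon> :: real
  defines "s \<equiv> \<Sum>i=1..d. ln (real (q i))" and "P \<equiv> \<Prod>i=1..d. ln (real (q i))"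
    and "U \<equiv> \<Prod>i=1..d. 2 * (1 + 1 / ln (real (q i)))"
  assumes d: "1 \<le> d" and q: "\<forall>i\<in>{1..d}. q i \<ge> 2"
    and h: "\<forall>i\<in>{1..d}. l < ln (real (q i)) * real h" and n: "2 * h + 1 \<le> n" and l: "s < l"
    and c: "0 < c" "c * real n ^ d \<le> real k"
    and big: "exp 1 * (real (\<Sum>i=1..d. q i) * U + U) * exp l
               \<le> c * ((l - s) ^ Suc d / (fact (Suc d) * P) / l)"
    and e: "0 < \<epsilon>" "\<epsilon> \<le> 1" "1 / real n \<le> \<epsilon>"
    and G: "exp (- (2 * ((l - s) ^ Suc d / (fact (Suc d) * P)))) \<le> \<epsilon> / real n"
  shows "measure_pmf.prob (pmf_of_set (multisets_of_size (grid d n) k))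
           {D. \<not> solvable (grid d n) (pebbling_move d q n) D} \<le> \<epsilon> * real (2 * h + 1) ^ d"
proof -
  let ?\<mu> = "pmf_of_set (multisets_of_size (grid d n) k)"
  define G' where "G' = (l - s) ^ Suc d / (fact (Suc d) * P)"
  let ?E = "\<lambda>v. {D. \<not> solvable_for (pebbling_move d q n) v D}"
  have n0: "0 < n" using n by simp
  have pt: "measure_pmf.prob ?\<mu> (?E v) \<le> \<epsilon> * (\<Prod>i=1..d. if deep n h (v i) then 1 / real n else 1)"
    if v: "v \<in> grid d n" for v
  proof -
    define j where "j = card {i\<in>{1..d}. deep n h (v i)}"
    have "measure_pmf.prob ?\<mu> (?E v) \<le> exp (- ((\<Prod>i=1..d. if deep n h (v i) then 2 else 1) * G'))"
      using prob_not_solvable_for_le[OF d q v h n, folded s_def P_def U_def, OF l c big]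
      by (simp add: G'_def)
    also have "(\<Prod>i=1..d. if deep n h (v i) then 2 else 1) = (2::real) ^ j"
      by (subst prod.inter_filter[symmetric]) (auto simp: j_def)
    also have "exp (- (2 ^ j * G')) \<le> \<epsilon> * (1 / real n) ^ j"
      using n0 e G unfolding G'_def by (rule exp_neg_two_power_le)
    also have "(1 / real n) ^ j = (\<Prod>i=1..d. if deep n h (v i) then 1 / real n else 1)"
      by (subst prod.inter_filter[symmetric]) (auto simp: j_def)
    finally show ?thesis .
  qed
  have "measure_pmf.prob ?\<mu> {D. \<not> solvable (grid d n) (pebbling_move d q n) D}
      = measure_pmf.prob ?\<mu> (\<Union>v\<in>grid d n. ?E v)"
    by (intro arg_cong2[where f = measure]) (auto simp: solvable_def)
  also have "\<dots> \<le> (\<Sum>v\<in>grid d n. measure_pmf.prob ?\<mu> (?E v))"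
    by (intro measure_pmf.finite_measure_subadditive_finite) auto
  also have "\<dots> \<le> (\<Sum>v\<in>grid d n. \<epsilon> * (\<Prod>i=1..d. if deep n h (v i) then 1 / real n else 1))"
    by (intro sum_mono pt)
  also have "\<dots> = \<epsilon> * (\<Sum>v\<in>grid d n. \<Prod>i=1..d. if deep n h (v i) then 1 / real n else 1)"
    by (simp add: sum_distrib_left)
  \<comment> \<open>The bound for \<open>v\<close> is a product over its coordinates, so the union
    bound factors: vertices of all types, from the corners to the interior, are summed at
    once.\<close>
  also have "(\<Sum>v\<in>grid d n. \<Prod>i=1..d. if deep n h (v i) then 1 / real n else 1)
      = (\<Prod>i=1..d. \<Sum>t=1..n. if deep n h t then 1 / real n else 1)"
    unfolding grid_def by (subst prod_sum_PiE) auto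
  also have "\<dots> \<le> (\<Prod>i=1..d. real (2 * h + 1))"
    using n0 by (intro prod_mono conjI sum_deep_le sum_nonneg) auto
  finally show ?thesis using e by (simp add: mult_left_mono)
qed

section \<open>Probability of being solvable\<close>

text \<open>An error \<open>exp (- \<bar>z\<bar>)\<close> would be sharper, but with
  \<open>z\<close> affine in the distance \<open>exp (\<theta> * z)\<close> is a pure exponential,
  which sums over the whole grid as a product of geometric series.\<close>

lemma ln_one_plus_exp_le:
  fixes z \<theta> :: real
  assumes "0 \<le> \<theta>" "\<theta> \<le> 1"
  shows "ln (1 + exp z) \<le> max 0 z + exp (\<theta> * z)"
proof (cases "0 \<le> z")
  case True
  have "ln (1 + exp z) = ln (exp z * (1 + exp (- z)))" by (simp add: algebra_simps flip: exp_add)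
  also have "\<dots> = z + ln (1 + exp (- z))" using add_pos_pos[of 1 "exp (- z)"] by (subst ln_mult) auto
  also have "ln (1 + exp (- z)) \<le> exp (- z)" by (rule ln_add_one_self_le_self) simp
  also have "exp (- z) \<le> 1" using True by simp
  also have "1 \<le> exp (\<theta> * z)" using True assms by simp
  finally show ?thesis using True by simp
next
  case False
  have "ln (1 + exp z) \<le> exp z" by (rule ln_add_one_self_le_self) simp
  also have "1 * z \<le> \<theta> * z" using False assms by (intro mult_right_mono_neg) auto
  hence "exp z \<le> exp (\<theta> * z)" by simp
  finally show ?thesis using False by simp
qed

text \<open>This is \<open>1 - exp (- y) \<ge> y / (1 + y)\<close>, written as an exponential so
  that the product over a box becomes a sum.\<close>

lemma one_minus_exp_neg_ge:
  fixes y :: real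
  assumes "0 < y"
  shows "exp (- ln (1 + 1 / y)) \<le> 1 - exp (- y)"
proof -
  have "exp (- ln (1 + 1 / y)) = 1 / (1 + 1 / y)"
    using assms by (simp add: exp_minus add_pos_pos divide_inverse)
  also have "\<dots> = 1 - 1 / (1 + y)" using assms by (simp add: field_simps)
  also have "\<dots> \<le> 1 - exp (- y)"
    using exp_ge_add_one_self[of y] assms by (simp add: exp_minus field_simps)
  finally show ?thesis .
qed

lemma geometric_tail_power_le:
  fixes c r :: real
  assumes r: "0 \<le> r" "r \<le> c / (c + 1)" and c: "0 < c"
  shows "r ^ m \<le> exp (- (real m / (c + 1)))"
proof -
  have "c / (c + 1) = 1 + (- 1 / (c + 1))" using c by (simp add: field_simps)
  also have "\<dots> \<le> exp (- 1 / (c + 1))" by (rule exp_ge_add_one_self)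
  finally have "r \<le> exp (- 1 / (c + 1))" using r by simp
  hence "r ^ m \<le> exp (- 1 / (c + 1)) ^ m" using r by (intro power_mono) auto
  thus ?thesis by (simp flip: exp_of_nat_mult)
qed

text \<open>The box constraints \<open>f w \<le> \<eta> * exp ((1 - \<theta>) * lam w)\<close> force the potential below 1 and
  cost no more than a simplex constraint, up to the factors absorbed in the bound.\<close>

lemma prob_geometric_box_ge:
  fixes lam :: "'v \<Rightarrow> real" and \<eta> \<theta> c r :: real
  assumes B: "finite B" and r: "0 \<le> r" "r \<le> c / (c + 1)" and c: "0 < c"
    and eta: "0 < \<eta>" and theta: "0 \<le> \<theta>" "\<theta> \<le> 1"
  defines "z \<equiv> \<lambda>w. ln ((c + 1) / \<eta>) - (1 - \<theta>) * lam w"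
  shows "exp (- (\<Sum>w\<in>B. max 0 (z w) + exp (\<theta> * z w)))
       \<le> (\<Prod>w\<in>B. measure_pmf.prob (geometric_pmf (1 - r)) {..nat \<lfloor>\<eta> * exp ((1 - \<theta>) * lam w)\<rfloor>})"
proof -
  have "c / (c + 1) < 1" using c by simp
  hence r1: "r < 1" using r by linarith
  have "exp (- (max 0 (z w) + exp (\<theta> * z w)))
      \<le> measure_pmf.prob (geometric_pmf (1 - r)) {..nat \<lfloor>\<eta> * exp ((1 - \<theta>) * lam w)\<rfloor>}" for w
  proof -
    \<comment> \<open>The bound on the count at \<open>w\<close> in units of \<open>c + 1\<close>: a
      count exceeds it with probability at most \<open>exp (- y)\<close>, and
      \<open>1 / y = exp (z w)\<close>.\<close>
    define y where "y = \<eta> * exp ((1 - \<theta>) * lam w) / (c + 1)"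
    define m where "m = nat \<lfloor>\<eta> * exp ((1 - \<theta>) * lam w)\<rfloor>"
    have y0: "0 < y" using eta c by (simp add: y_def)
    have "1 / y = exp (z w)" using eta c by (simp add: y_def z_def exp_diff)
    hence "ln (1 + 1 / y) \<le> max 0 (z w) + exp (\<theta> * z w)" using ln_one_plus_exp_le theta by simp
    hence "exp (- (max 0 (z w) + exp (\<theta> * z w))) \<le> exp (- ln (1 + 1 / y))" by simp
    also have "\<dots> \<le> 1 - exp (- y)" by (rule one_minus_exp_neg_ge[OF y0])
    also have "\<dots> \<le> 1 - r ^ Suc m"
    proof -
      have "\<eta> * exp ((1 - \<theta>) * lam w) \<le> real (Suc m)"
        using eta unfolding m_def by linarith
      hence "y \<le> real (Suc m) / (c + 1)" using c unfolding y_def by (intro divide_right_mono) auto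
      hence "exp (- (real (Suc m) / (c + 1))) \<le> exp (- y)" by simp
      thus ?thesis using geometric_tail_power_le[OF r c, of "Suc m"] by linarith
    qed
    also have "\<dots> = measure_pmf.prob (geometric_pmf (1 - r)) {..m}"
      by (rule prob_geometric_atMost[OF r(1) r1, symmetric])
    finally show ?thesis by (simp add: m_def)
  qed
  hence "(\<Prod>w\<in>B. exp (- (max 0 (z w) + exp (\<theta> * z w))))
    \<le> (\<Prod>w\<in>B. measure_pmf.prob (geometric_pmf (1 - r)) {..nat \<lfloor>\<eta> * exp ((1 - \<theta>) * lam w)\<rfloor>})"
    by (intro prod_mono) auto
  thus ?thesis using B by (simp add: exp_sum flip: sum_negf)
qed

text \<open>The restriction to \<open>{1..d}\<close> makes the function extensional, as the elements
  of \<open>grid d n\<close> are.\<close>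

definition edge_vertex :: "nat \<Rightarrow> nat \<Rightarrow> nat \<Rightarrow> nat" where
  "edge_vertex d t = (\<lambda>i\<in>{1..d}. if i = 1 then t else 1)"

lemma edge_vertex_in_grid: "1 \<le> t \<Longrightarrow> t \<le> n \<Longrightarrow> edge_vertex d t \<in> grid d n"
  by (auto simp: edge_vertex_def grid_def)

text \<open>Only coordinate 1 is restricted, which is enough to make slabs around distant vertices
  of the edge disjoint. The two inequalities avoid subtraction on \<open>nat\<close>.\<close>

definition slab :: "nat \<Rightarrow> nat \<Rightarrow> nat \<Rightarrow> nat \<Rightarrow> (nat \<Rightarrow> nat) set" where
  "slab d n T t = {w \<in> grid d n. w 1 \<le> t + T \<and> t \<le> w 1 + T}"

text \<open>Inside the slab the box leaves a weight of at most
  \<open>\<eta> * exp (- (\<theta> * lam w))\<close> at \<open>w\<close>, and by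
  \<open>small\<close> these add up to at most \<open>1 / 2\<close>. Each of the at most
  \<open>k\<close> pebbles outside weighs at most \<open>1 / 2 ^ T\<close>, together less than
  \<open>1 / 2\<close>.\<close>

lemma potential_lt_one_if_box:
  fixes d n T t :: nat and q :: "nat \<Rightarrow> nat" and \<eta> \<theta> :: real
  assumes d: "1 \<le> d" and q: "\<forall>i\<in>{1..d}. q i \<ge> 2" and t: "1 \<le> t" "t \<le> n"
    and eta: "0 < \<eta>" and theta: "0 < \<theta>"
    and small: "\<eta> * (\<Prod>i=1..d. 2 * (1 + 1 / (\<theta> * ln (real (q i))))) \<le> 1 / 2"
    and T: "2 * k < 2 ^ T" and D: "D \<in> multisets_of_size (grid d n) k"
    and box: "count D \<in> Pi (slab d n T t)
               (\<lambda>w. {..nat \<lfloor>\<eta> * exp ((1 - \<theta>) * log_dist d q (edge_vertex d t) w)\<rfloor>})"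
  shows "potential d q (edge_vertex d t) D < 1"
proof -
  define v where "v = edge_vertex d t"
  define lam where "lam w = log_dist d q v w" for w
  let ?S = "slab d n T t"
  have Dg: "set_mset D \<subseteq> grid d n" "size D = k" using D by (auto simp: multisets_of_size_def)
  have a: "0 < ln (real (q i))" if "i \<in> {1..d}" for i using q that by (auto simp: Ball_def)
  have vg: "v \<in> grid d n" using t by (simp add: v_def edge_vertex_in_grid)
  have v1: "v 1 = t" using d by (simp add: v_def edge_vertex_def)
  have SV: "?S \<subseteq> grid d n" by (auto simp: slab_def)
  have "potential d q v D = (\<Sum>w\<in>grid d n. real (count D w) * exp (- lam w))"
    using Dg by (simp add: potential_def lam_def sum_mset_eq_sum_count)
  also have "\<dots> = (\<Sum>w\<in>?S. real (count D w) * exp (- lam w)) + (\<Sum>w\<in>grid d n - ?S. real (count D w) * exp (- lam w))"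
    using SV by (subst add.commute, intro sum.subset_diff) auto
  also have "(\<Sum>w\<in>?S. real (count D w) * exp (- lam w)) \<le> 1 / 2"
  proof -
    have "(\<Sum>w\<in>?S. real (count D w) * exp (- lam w)) \<le> (\<Sum>w\<in>?S. \<eta> * exp (- (\<theta> * lam w)))"
    proof (intro sum_mono)
      fix w assume "w \<in> ?S"
      hence "count D w \<le> nat \<lfloor>\<eta> * exp ((1 - \<theta>) * lam w)\<rfloor>" using box by (auto simp: lam_def v_def)
      hence "real (count D w) \<le> \<eta> * exp ((1 - \<theta>) * lam w)"
        using eta by (simp add: le_nat_iff le_floor_iff)
      hence "real (count D w) * exp (- lam w) \<le> \<eta> * exp ((1 - \<theta>) * lam w) * exp (- lam w)"
        by (intro mult_right_mono) auto
      also have "\<dots> = \<eta> * exp (- (\<theta> * lam w))" by (simp add: algebra_simps flip: exp_add)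
      finally show "real (count D w) * exp (- lam w) \<le> \<eta> * exp (- (\<theta> * lam w))" .
    qed
    also have "\<dots> \<le> (\<Sum>w\<in>grid d n. \<eta> * exp (- (\<theta> * lam w)))"
      using SV eta by (intro sum_mono2) auto
    also have "\<dots> = \<eta> * (\<Sum>w\<in>grid d n. exp (- (\<theta> * lam w)))" by (simp add: sum_distrib_left)
    also have "\<dots> \<le> \<eta> * (\<Prod>i=1..d. 2 * (1 + 1 / (\<theta> * ln (real (q i)))))"
      using eta theta a vg unfolding lam_def grid_def
      by (intro mult_left_mono sum_exp_wdist_le) (auto dest: PiE_mem)
    finally show ?thesis using small by simp
  qed
  also have "(\<Sum>w\<in>grid d n - ?S. real (count D w) * exp (- lam w)) < 1 / 2"
  proof -
    have "exp (- lam w) \<le> 1 / 2 ^ T" if w: "w \<in> grid d n - ?S" for w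
    proof -
      have "real T \<le> \<bar>real (w 1) - real (v 1)\<bar>" using w v1 by (auto simp: slab_def)
      moreover have "2 \<le> q 1" using q d by auto
      hence "ln 2 \<le> ln (real (q 1))" by simp
      ultimately have "real T * ln 2 \<le> \<bar>real (w 1) - real (v 1)\<bar> * ln (real (q 1))"
        by (intro mult_mono) auto
      also have "\<dots> = ln (real (q 1)) * \<bar>real (w 1) - real (v 1)\<bar>" by simp
      also have "\<dots> \<le> lam w" unfolding lam_def wdist_def
        using d by (intro member_le_sum) (auto intro!: mult_nonneg_nonneg less_imp_le[OF a])
      finally have "exp (- lam w) \<le> exp (- (real T * ln 2))" by simp
      also have "\<dots> = 1 / 2 ^ T" by (simp add: exp_minus exp_of_nat_mult divide_inverse)
      finally show ?thesis .
    qed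
    hence "(\<Sum>w\<in>grid d n - ?S. real (count D w) * exp (- lam w))
        \<le> (\<Sum>w\<in>grid d n - ?S. real (count D w) * (1 / 2 ^ T))"
      by (intro sum_mono mult_left_mono) auto
    also have "\<dots> \<le> (\<Sum>w\<in>grid d n. real (count D w) * (1 / 2 ^ T))"
      by (intro sum_mono2) auto
    also have "\<dots> = (\<Sum>w\<in>#D. 1 / 2 ^ T)"
      using Dg by (subst sum_mset_eq_sum_count[of "grid d n"]) auto
    also have "\<dots> = real k / 2 ^ T" using Dg by simp
    also have "\<dots> < 1 / 2"
    proof -
      have "real (2 * k) < real (2 ^ T)" using T by (simp only: of_nat_less_iff)
      thus ?thesis by (simp add: field_simps)
    qed
    finally show ?thesis .
  qed
  finally show ?thesis by (simp add: v_def)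
qed

text \<open>In a solvable configuration no edge vertex \<open>v j\<close> has its box constraints
  satisfied. The \<open>m\<close> boxes live on disjoint slabs, so for geometric counts they are
  independent, each satisfied with probability at least \<open>exp (- X)\<close>; all of them fail
  with probability at most \<open>(1 - exp (- X)) ^ m\<close>.\<close>

lemma prob_solvable_le:
  fixes d n k m T :: nat and q :: "nat \<Rightarrow> nat" and c \<eta> \<theta> X :: real
  defines "s \<equiv> \<Sum>i=1..d. ln (real (q i))" and "P \<equiv> \<Prod>i=1..d. ln (real (q i))"
    and "b \<equiv> ln ((c + 1) / \<eta>)"
  assumes d: "1 \<le> d" and q: "\<forall>i\<in>{1..d}. q i \<ge> 2" and n: "0 < n"
    and c: "0 < c" "real k \<le> c * real n ^ d"
    and eta: "0 < \<eta>" and theta: "0 < \<theta>" "\<theta> < 1"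
    and small: "\<eta> * (\<Prod>i=1..d. 2 * (1 + 1 / (\<theta> * ln (real (q i))))) \<le> 1 / 2"
    and T: "2 * k < 2 ^ T" and m: "m * (2 * T + 1) \<le> n"
    and X: "2 * (max 0 (b / (1 - \<theta>) + s) ^ Suc d / (fact (Suc d) * P))
        + exp (\<theta> * b) * (\<Prod>i=1..d. 2 * (1 + 1 / (\<theta> * (1 - \<theta>) * ln (real (q i))))) \<le> X"
  shows "measure_pmf.prob (pmf_of_set (multisets_of_size (grid d n) k))
           {D. solvable (grid d n) (pebbling_move d q n) D}
       \<le> (real (n ^ d + k) + 1)\<^sup>2 * exp (- (real m * exp (- X)))"
proof -
  define r where "r = real k / real (card (grid d n) + k)"
  \<comment> \<open>Centres spaced \<open>2 * T + 1\<close> apart, starting at \<open>T + 1\<close>: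
    the slabs of half-width \<open>T\<close> around them are disjoint, and \<open>m\<close> of them
    fit into the edge.\<close>
  define t where "t j = j * (2 * T + 1) + T + 1" for j
  define v where "v j = edge_vertex d (t j)" for j
  define lam where "lam j w = log_dist d q (v j) w" for j w
  define M where "M = (\<lambda>j w. {..nat \<lfloor>\<eta> * exp ((1 - \<theta>) * lam j w)\<rfloor>})"
  define B where "B j = slab d n T (t j)" for j
  let ?G = "Pi_pmf (grid d n) 0 (\<lambda>_. geometric_pmf (1 - r))"
  have a: "0 < ln (real (q i))" if "i \<in> {1..d}" for i using q that by (auto simp: Ball_def)
  have P0: "0 < P" unfolding P_def using a by (intro prod_pos) auto
  have t: "1 \<le> t j" "t j \<le> n" if "j < m" for j
  proof -
    have "Suc j * (2 * T + 1) \<le> m * (2 * T + 1)" using that by (intro mult_right_mono) auto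
    thus "1 \<le> t j" "t j \<le> n" using m by (auto simp: t_def)
  qed
  have vg: "v j \<in> grid d n" if "j < m" for j using t[OF that] by (simp add: v_def edge_vertex_in_grid)
  have Bsub: "B j \<subseteq> grid d n" for j by (auto simp: B_def slab_def)
  have ne: "grid d n \<noteq> {}" using edge_vertex_in_grid[of 1 n d] n by auto
  have disj: "disjoint_family_on B {..<m}"
  unfolding disjoint_family_on_def
  proof (intro ballI impI)
    have *: "B i \<inter> B j = {}" if "i < j" for i j
    proof -
      have "Suc i * (2 * T + 1) \<le> j * (2 * T + 1)" using that by (intro mult_right_mono) auto
      thus ?thesis by (auto simp: B_def slab_def t_def)
    qed
    fix i j :: nat assume "i \<noteq> j"
    thus "B i \<inter> B j = {}" using *[of i j] *[of j i] by (cases "i < j") auto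
  qed
  have r: "0 \<le> r" "r \<le> c / (c + 1)"
  proof -
    show "0 \<le> r" by (simp add: r_def)
    have "real k * (c + 1) \<le> c * (real n ^ d + real k)" using c by (simp add: algebra_simps)
    thus "r \<le> c / (c + 1)" using c n by (simp add: r_def card_grid divide_simps mult.commute add_pos_nonneg)
  qed
  have p: "exp (- X) \<le> (\<Prod>w\<in>B j. measure_pmf.prob (geometric_pmf (1 - r)) (M j w))" if j: "j < m" for j
  proof -
    let ?z = "\<lambda>w. b - (1 - \<theta>) * lam j w"
    have th: "0 < 1 - \<theta>" using theta by simp
    have vi: "v j i \<in> {1..n}" if "i \<in> {1..d}" for i using vg[OF j] that by (auto simp: grid_def dest: PiE_mem)
    have "(\<Sum>w\<in>B j. max 0 (?z w) + exp (\<theta> * ?z w)) \<le> (\<Sum>w\<in>grid d n. max 0 (?z w) + exp (\<theta> * ?z w))"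
      using Bsub by (intro sum_mono2) (auto intro: add_nonneg_nonneg)
    also have "\<dots> = (\<Sum>w\<in>grid d n. max 0 (?z w)) + (\<Sum>w\<in>grid d n. exp (\<theta> * ?z w))"
      by (rule sum.distrib)
    also have "(\<Sum>w\<in>grid d n. max 0 (?z w)) \<le> 2 * (max 0 (b / (1 - \<theta>) + s) ^ Suc d / (fact (Suc d) * P))"
    proof -
      \<comment> \<open>Factoring \<open>1 - \<theta>\<close> out of the summand, and bounding it by
        1, leaves a simplex sum of radius \<open>b / (1 - \<theta>)\<close>.\<close>
      have "(\<Sum>w\<in>grid d n. max 0 (?z w)) \<le> (\<Sum>w\<in>grid d n. max 0 (b / (1 - \<theta>) - lam j w))"
      proof (intro sum_mono)
        fix w
        have "max 0 (?z w) = (1 - \<theta>) * max 0 (b / (1 - \<theta>) - lam j w)"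
        proof -
          have "(1 - \<theta>) * (b / (1 - \<theta>) - lam j w) = ?z w" using th by (simp add: right_diff_distrib)
          thus ?thesis using th by (subst max_mult_distrib_left) simp
        qed
        also have "\<dots> \<le> 1 * max 0 (b / (1 - \<theta>) - lam j w)"
          using theta by (intro mult_right_mono) auto
        finally show "max 0 (?z w) \<le> max 0 (b / (1 - \<theta>) - lam j w)" by simp
      qed
      also have "\<dots> \<le> (\<Prod>i=1..d. if v j i = 1 then 1 else 2) *
           (max 0 (b / (1 - \<theta>) + s) ^ Suc d / (fact (Suc d) * P))"
        using sum_pos_part_wdist_le[of "{1..d}" "\<lambda>i. ln (real (q i))" "v j" n "b / (1 - \<theta>)"] a vi
        unfolding lam_def grid_def s_def P_def by simp
      \<comment> \<open>All coordinates of an edge vertex but the first are 1, so at most one factor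
        is 2. The resulting constant matches the one for solvability.\<close>
      also have "\<dots> \<le> 2 * (max 0 (b / (1 - \<theta>) + s) ^ Suc d / (fact (Suc d) * P))"
      proof (intro mult_right_mono)
        have "(\<Prod>i=1..d. if v j i = 1 then 1 else 2) = (if v j 1 = 1 then 1 else 2) * (\<Prod>i\<in>{1..d}-{1}. if v j i = 1 then 1 else (2::real))"
          using d by (intro prod.remove) auto
        also have "(\<Prod>i\<in>{1..d}-{1}. if v j i = 1 then 1 else (2::real)) = 1"
          by (intro prod.neutral) (auto simp: v_def edge_vertex_def)
        finally show "(\<Prod>i=1..d. if v j i = 1 then 1 else 2) \<le> (2::real)" by simp
      qed (use P0 in auto)
      finally show ?thesis .
    qed
    also have "(\<Sum>w\<in>grid d n. exp (\<theta> * ?z w)) = exp (\<theta> * b) * (\<Sum>w\<in>grid d n. exp (- (\<theta> * (1 - \<theta>) * lam j w)))"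
      by (simp add: sum_distrib_left algebra_simps flip: exp_add)
    also have "\<dots> \<le> exp (\<theta> * b) * (\<Prod>i=1..d. 2 * (1 + 1 / (\<theta> * (1 - \<theta>) * ln (real (q i)))))"
      using theta a vi unfolding lam_def grid_def
      by (intro mult_left_mono sum_exp_wdist_le) auto
    finally have "(\<Sum>w\<in>B j. max 0 (?z w) + exp (\<theta> * ?z w)) \<le> X" using X by simp
    hence "exp (- X) \<le> exp (- (\<Sum>w\<in>B j. max 0 (?z w) + exp (\<theta> * ?z w)))" by simp
    also have "\<dots> \<le> (\<Prod>w\<in>B j. measure_pmf.prob (geometric_pmf (1 - r)) (M j w))"
      unfolding M_def b_def using r c eta theta finite_subset[OF Bsub finite_grid]
      by (intro prob_geometric_box_ge) auto
    finally show ?thesis .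
  qed
  have "measure_pmf.prob (pmf_of_set (multisets_of_size (grid d n) k))
           {D. solvable (grid d n) (pebbling_move d q n) D}
       \<le> (real (card (grid d n) + k) + 1)\<^sup>2 * measure_pmf.prob ?G {f. \<forall>j\<in>{..<m}. f \<notin> Pi (B j) (M j)}"
    unfolding r_def
  proof (rule prob_multisets_le_geometric, goal_cases)
    case (3 D)
    show ?case
    proof (intro ballI notI)
      fix j assume "j \<in> {..<m}" and box: "count D \<in> Pi (B j) (M j)"
      hence j: "j < m" by simp
      have "potential d q (v j) D < 1"
        unfolding v_def
        by (rule potential_lt_one_if_box[OF d q t[OF j] eta theta(1) small T 3(1)])
           (use box in \<open>simp add: B_def M_def lam_def v_def\<close>)
      moreover have "1 \<le> potential d q (v j) D"
        using 3(2) vg[OF j] q by (intro one_le_potential_if_solvable_for) (auto simp: solvable_def)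
      ultimately show False by simp
    qed
  qed (use ne in auto)
  also have "measure_pmf.prob ?G {f. \<forall>j\<in>{..<m}. f \<notin> Pi (B j) (M j)}
      = (\<Prod>j<m. 1 - (\<Prod>w\<in>B j. measure_pmf.prob (geometric_pmf (1 - r)) (M j w)))"
    using Bsub disj by (intro prob_Pi_pmf_no_cylinder) auto
  also have "\<dots> \<le> (\<Prod>j<m. exp (- exp (- X)))"
  proof (intro prod_mono conjI)
    fix j assume "j \<in> {..<m}"
    hence "1 - (\<Prod>w\<in>B j. measure_pmf.prob (geometric_pmf (1 - r)) (M j w)) \<le> 1 + (- exp (- X))"
      using p by simp
    also have "\<dots> \<le> exp (- exp (- X))" by (rule exp_ge_add_one_self)
    finally show "1 - (\<Prod>w\<in>B j. measure_pmf.prob (geometric_pmf (1 - r)) (M j w)) \<le> exp (- exp (- X))" .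
    show "0 \<le> 1 - (\<Prod>w\<in>B j. measure_pmf.prob (geometric_pmf (1 - r)) (M j w))"
      by (auto intro!: prod_le_1)
  qed
  also have "\<dots> = exp (- (real m * exp (- X)))"
    by (simp flip: exp_of_nat_mult)
  finally show ?thesis by (simp add: card_grid mult_left_mono)
qed

section \<open>Asymptotics\<close>

text \<open>The growth conditions in \<open>prob_solvable_ge_half\<close> and
  \<open>prob_solvable_less_half\<close> are all written as
  \<open>A * L ^ m \<le> exp (B * L)\<close>, even with factors or exponents 1, so that this lemma
  discharges them directly.\<close>

lemma eventually_monomial_le_exp:
  fixes A B :: real
  assumes "0 < B"
  shows "\<forall>\<^sub>F x in at_top. A * x ^ m \<le> exp (B * x)"
proof -
  have B: "filterlim (\<lambda>x::real. B * x) at_top at_top"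
    using assms by (intro filterlim_tendsto_pos_mult_at_top[OF tendsto_const] filterlim_ident)
  have "((\<lambda>x. (B * x) ^ m / exp (B * x)) \<longlongrightarrow> 0) at_top"
    by (rule filterlim_compose[OF tendsto_power_div_exp_0 B])
  hence "\<forall>\<^sub>F x in at_top. (B * x) ^ m / exp (B * x) < B ^ m / (\<bar>A\<bar> + 1)"
    using assms by (intro order_tendstoD(2)) auto
  moreover have "\<forall>\<^sub>F x in at_top. (0::real) \<le> x" by (rule eventually_ge_at_top)
  ultimately show ?thesis
  proof eventually_elim
    case (elim x)
    have "B ^ m * (x ^ m * (\<bar>A\<bar> + 1)) < B ^ m * exp (B * x)"
      using elim(1) by (simp add: power_mult_distrib divide_less_eq pos_less_divide_eq mult_ac)
    hence "x ^ m * (\<bar>A\<bar> + 1) \<le> exp (B * x)" using assms by simp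
    moreover have "A * x ^ m \<le> (\<bar>A\<bar> + 1) * x ^ m" using elim by (intro mult_right_mono) auto
    ultimately show ?case by (simp add: mult.commute)
  qed
qed

text \<open>The radius at which the leading term \<open>2 * L ^ (d + 1) / (fact (d + 1) *
  (\<Prod>i=1..d. ln (real (q i))))\<close> of the exponent for an edge vertex equals
  \<open>ln n\<close>.\<close>

definition log_scale :: "nat \<Rightarrow> (nat \<Rightarrow> nat) \<Rightarrow> nat \<Rightarrow> real" where
  "log_scale d q n = (fact (d + 1) * ln (real n) * (\<Prod>i=1..d. ln (real (q i))) / 2) powr (1 / (real d + 1))"

lemma log_scale_power:
  assumes q: "\<forall>i\<in>{1..d}. q i \<ge> 2" and n: "2 \<le> n"
  shows "log_scale d q n ^ Suc d = fact (Suc d) * (\<Prod>i=1..d. ln (real (q i))) * ln (real n) / 2"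
    and "0 < log_scale d q n"
proof -
  let ?x = "fact (d + 1) * ln (real n) * (\<Prod>i=1..d. ln (real (q i))) / 2"
  have "0 < (\<Prod>i=1..d. ln (real (q i)))" using q by (intro prod_pos) (auto simp: Ball_def)
  hence x: "0 < ?x" using n by simp
  have "log_scale d q n ^ Suc d = ?x powr (1 / (real d + 1) * real (Suc d))"
    unfolding log_scale_def using x by (subst powr_power) (auto simp del: of_nat_Suc mult_eq_0_iff prod_zero_iff)
  also have "1 / (real d + 1) * real (Suc d) = 1" by (simp add: field_simps)
  also have "?x powr 1 = ?x" using x by (intro powr_one) linarith
  finally show "log_scale d q n ^ Suc d = fact (Suc d) * (\<Prod>i=1..d. ln (real (q i))) * ln (real n) / 2"
    by (simp add: mult_ac)
  show "0 < log_scale d q n" unfolding log_scale_def using x by (subst powr_gt_zero) linarith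
qed

lemma filterlim_log_scale:
  assumes q: "\<forall>i\<in>{1..d}. q i \<ge> 2"
  shows "filterlim (log_scale d q) at_top sequentially"
proof -
  let ?P = "\<Prod>i=1..d. ln (real (q i))"
  have P: "0 < ?P" using q by (intro prod_pos) (auto simp: Ball_def)
  have lim: "filterlim (\<lambda>n. fact (Suc d) * ?P / 2 * ln (real n)) at_top sequentially"
    using P by (intro filterlim_tendsto_pos_mult_at_top[OF tendsto_const]
        filterlim_compose[OF ln_at_top] filterlim_real_sequentially) auto
  show ?thesis
    unfolding filterlim_at_top_ge[where c = 0]
  proof (intro allI impI)
    fix Z :: real assume Z: "0 \<le> Z"
    have "\<forall>\<^sub>F n in sequentially. Z ^ Suc d \<le> fact (Suc d) * ?P / 2 * ln (real n)"
      using lim by (simp only: filterlim_at_top)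
    thus "\<forall>\<^sub>F n in sequentially. Z \<le> log_scale d q n"
      using eventually_ge_at_top[of 2]
    proof eventually_elim
      case (elim n)
      have "Z ^ Suc d \<le> log_scale d q n ^ Suc d"
        using elim log_scale_power(1)[OF q, of n] by simp
      thus ?case using log_scale_power(2)[OF q, of n] elim by (meson less_imp_le power_le_imp_le_base)
    qed
  qed
qed

lemma sum_prod_ln_pos:
  assumes q: "\<forall>i\<in>{1..d}. q i \<ge> (2::nat)"
  shows "0 < (\<Prod>i=1..d. ln (real (q i)))" "0 \<le> (\<Sum>i=1..d. ln (real (q i)))"
    "0 < (\<Prod>i=1..d. 2 * (1 + 1 / ln (real (q i))))"
proof -
  have a: "0 < ln (real (q i))" if "i \<in> {1..d}" for i using q that by (auto simp: Ball_def)
  show "0 < (\<Prod>i=1..d. ln (real (q i)))" using a by (intro prod_pos) auto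
  show "0 \<le> (\<Sum>i=1..d. ln (real (q i)))" using a by (intro sum_nonneg) (auto intro: less_imp_le)
  show "0 < (\<Prod>i=1..d. 2 * (1 + 1 / ln (real (q i))))"
    by (intro prod_pos) (auto intro!: add_pos_pos a)
qed

section \<open>Choice of the parameters at scale \<open>L\<close>\<close>

lemma power_Suc_add_one_ge:
  fixes L :: real
  assumes "0 \<le> L"
  shows "(L + 1) * L ^ d \<le> (L + 1) ^ Suc d"
  using assms power_mono[of L "L + 1" d] by simp

text \<open>The radius is chosen with \<open>l - s = L + 1\<close>, so that the exponent exceeds
  \<open>ln n\<close> by at least \<open>2 / \<kappa> * L ^ d\<close>. The excess is passed on as
  \<open>\<epsilon>\<close>, which beats the factor \<open>(2 * h + 1) ^ d\<close> of the union
  bound, of order \<open>L ^ d\<close>. The constant \<open>C\<close> is what \<open>big\<close>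
  demands of \<open>c\<close>.\<close>

lemma prob_solvable_ge_half:
  fixes d n :: nat and q :: "nat \<Rightarrow> nat" and L :: real
  defines "s \<equiv> \<Sum>i=1..d. ln (real (q i))" and "P \<equiv> \<Prod>i=1..d. ln (real (q i))"
    and "U \<equiv> \<Prod>i=1..d. 2 * (1 + 1 / ln (real (q i)))"
  defines "\<kappa> \<equiv> fact (Suc d) * P"
  defines "K \<equiv> exp 1 * (real (\<Sum>i=1..d. q i) * U + U)"
  defines "C \<equiv> max 0 (ln (K * \<kappa> * (s + 2)) + s + 1)"
  defines "A \<equiv> 2 * (s + 2) / ln 2 + 5"
  assumes d: "1 \<le> d" and q: "\<forall>i\<in>{1..d}. q i \<ge> 2" and L: "1 \<le> L"
    and n: "0 < n" "ln (real n) = 2 / \<kappa> * L ^ Suc d"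
    and e1: "A * L ^ 1 \<le> exp (2 / \<kappa> * L)" and e2: "2 * A ^ d * L ^ d \<le> exp (2 / \<kappa> * L)"
    and e3: "1 * L ^ d \<le> exp (1 * L)"
  shows "\<exists>k. real k \<le> 2 * (real n ^ d * (exp L * exp C / L ^ d)) \<and>
     1 / 2 \<le> measure_pmf.prob (pmf_of_set (multisets_of_size (grid d n) k))
           {D. solvable (grid d n) (pebbling_move d q n) D}"
proof -
  have s0: "0 \<le> s" and P0: "0 < P" and U0: "0 < U"
    using sum_prod_ln_pos[OF q] by (simp_all add: s_def P_def U_def)
  have k0: "0 < \<kappa>" using P0 by (simp add: \<kappa>_def)
  have K0: "0 < K" unfolding K_def using U0
    by (intro mult_pos_pos add_nonneg_pos mult_nonneg_nonneg of_nat_0_le_iff) auto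
  define l where "l = L + s + 1"
  \<comment> \<open>As \<open>q i \<ge> 2\<close>, more than \<open>l / ln 2\<close> steps in any
    coordinate lead beyond distance \<open>l\<close>.\<close>
  define h where "h = nat \<lceil>l / ln 2\<rceil> + 1"
  define c where "c = exp L * exp C / L ^ d"
  define \<epsilon> where "\<epsilon> = exp (- (2 / \<kappa> * L ^ d))"
  define k where "k = nat \<lceil>real n ^ d * c\<rceil>"
  let ?\<mu> = "pmf_of_set (multisets_of_size (grid d n) k)"
  have l0: "0 < l" using L s0 by (simp add: l_def)
  have n1: "1 \<le> real n" using n by simp
  have nexp: "real n = exp (2 / \<kappa> * L ^ Suc d)" using n by (metis exp_ln of_nat_0_less_iff)
  have Ld: "L \<le> L ^ d" using L d power_increasing[of 1 d L] by simp
  have LSd: "L ^ d \<le> L ^ Suc d" using L by (intro power_increasing) auto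
  have h_bounds: "l / ln 2 < real h" "real h \<le> l / ln 2 + 2"
    using l0 unfolding h_def by (auto intro: less_imp_le) linarith+
  have h: "\<forall>i\<in>{1..d}. l < ln (real (q i)) * real h"
  proof
    fix i assume "i \<in> {1..d}"
    hence "2 \<le> q i" using q by auto
    hence "ln 2 \<le> ln (real (q i))" by simp
    moreover have "l < ln 2 * real h" using h_bounds(1) by (simp add: field_simps)
    ultimately show "l < ln (real (q i)) * real h"
      by (meson less_le_trans mult_right_mono of_nat_0_le_iff)
  qed
  have hA: "real (2 * h + 1) \<le> A * L"
  proof -
    have "l \<le> (s + 2) * L" using L s0 mult_left_mono[of 1 L "s + 1"] by (simp add: l_def algebra_simps)
    hence "l / ln 2 \<le> (s + 2) * L / ln 2" by (intro divide_right_mono) auto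
    hence "2 * (l / ln 2) + 5 \<le> 2 * ((s + 2) * L / ln 2) + 5 * L" using L by linarith
    also have "\<dots> = A * L" by (simp add: A_def algebra_simps)
    finally show ?thesis using h_bounds(2) by simp
  qed
  have nh: "2 * h + 1 \<le> n"
  proof -
    have "real (2 * h + 1) \<le> exp (2 / \<kappa> * L)" using hA e1 by simp
    also have "\<dots> \<le> real n" unfolding nexp using k0 Ld LSd by (simp add: divide_right_mono)
    finally show ?thesis by (simp only: of_nat_le_iff)
  qed
  have c1: "1 \<le> c"
  proof -
    have "L ^ d \<le> exp L * 1" using e3 by simp
    also have "\<dots> \<le> exp L * exp C" by (intro mult_left_mono) (auto simp: C_def)
    finally show ?thesis using L by (simp add: c_def)
  qed
  have nd1: "1 \<le> real n ^ d * c" using n1 c1 by (metis mult_mono' mult_1 one_le_power zero_le_one)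
  have kge: "c * real n ^ d \<le> real k" unfolding k_def by (simp add: mult.commute) linarith
  have kle: "real k \<le> 2 * (real n ^ d * c)" unfolding k_def using nd1 by linarith
  have ls: "l - s = L + 1" by (simp add: l_def)
  have "measure_pmf.prob ?\<mu> {D. \<not> solvable (grid d n) (pebbling_move d q n) D} \<le> \<epsilon> * real (2 * h + 1) ^ d"
  proof (rule prob_not_solvable_le[OF d q h nh, folded s_def P_def U_def])
    show "s < l" using L by (simp add: l_def)
    show "0 < c" using c1 by simp
    show "c * real n ^ d \<le> real k" by (rule kge)
    show "exp 1 * (real (\<Sum>i=1..d. q i) * U + U) * exp l \<le> c * ((l - s) ^ Suc d / (fact (Suc d) * P) / l)"
    proof -
      have "K * \<kappa> * (s + 2) * exp (s + 1) \<le> exp C"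
      proof -
        have "0 < K * \<kappa> * (s + 2)" using K0 k0 s0 by simp
        hence "K * \<kappa> * (s + 2) * exp (s + 1) = exp (ln (K * \<kappa> * (s + 2)) + s + 1)"
          by (simp add: exp_add)
        also have "\<dots> \<le> exp C" by (simp add: C_def)
        finally show ?thesis .
      qed
      hence "K * exp l * (\<kappa> * (s + 2)) \<le> exp L * exp C"
        by (simp add: l_def exp_add mult_ac)
      hence 1: "K * exp l \<le> exp L * exp C / (\<kappa> * (s + 2))"
        using k0 s0 by (subst pos_le_divide_eq) auto
      \<comment> \<open>With \<open>l\<close> at most \<open>(s + 2) * (L + 1)\<close>, the quotient
        \<open>(L + 1) ^ Suc d / l\<close> makes up for the denominator \<open>L ^ d\<close> of
        \<open>c\<close>.\<close>
      have "L + s + 1 \<le> (s + 2) * (L + 1)" using L s0 by (simp add: algebra_simps)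
      hence "l * L ^ d \<le> (s + 2) * ((L + 1) * L ^ d)"
        using L by (simp add: l_def mult.assoc[symmetric] mult_right_mono)
      also have "\<dots> \<le> (s + 2) * (L + 1) ^ Suc d"
        using L s0 by (intro mult_left_mono power_Suc_add_one_ge) auto
      finally have "1 / (s + 2) \<le> (L + 1) ^ Suc d / (l * L ^ d)"
        using l0 L s0 by (simp add: divide_simps mult.commute)
      hence "exp L * exp C / \<kappa> * (1 / (s + 2)) \<le> exp L * exp C / \<kappa> * ((L + 1) ^ Suc d / (l * L ^ d))"
        using k0 by (intro mult_left_mono) auto
      hence "exp L * exp C / (\<kappa> * (s + 2)) \<le> c * ((L + 1) ^ Suc d / \<kappa> / l)"
        by (simp add: c_def mult_ac)
      with 1 show ?thesis unfolding ls K_def \<kappa>_def by simp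
    qed
    show "0 < \<epsilon>" by (simp add: \<epsilon>_def)
    show "\<epsilon> \<le> 1" using k0 L by (simp add: \<epsilon>_def)
    show "1 / real n \<le> \<epsilon>"
      unfolding nexp \<epsilon>_def using k0 LSd by (simp add: exp_minus field_simps)
    show "exp (- (2 * ((l - s) ^ Suc d / (fact (Suc d) * P)))) \<le> \<epsilon> / real n"
    proof -
      have "L ^ Suc d + L ^ d \<le> (L + 1) ^ Suc d"
        using power_Suc_add_one_ge[of L d] L by (simp add: algebra_simps)
      hence "2 / \<kappa> * (L ^ Suc d + L ^ d) \<le> 2 / \<kappa> * (L + 1) ^ Suc d"
        using k0 by (intro mult_left_mono) auto
      hence "exp (- (2 / \<kappa> * (L + 1) ^ Suc d)) \<le> exp (- (2 / \<kappa> * L ^ d) - 2 / \<kappa> * L ^ Suc d)"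
        unfolding distrib_left by simp
      also have "\<dots> = \<epsilon> / real n" unfolding nexp \<epsilon>_def by (rule exp_diff)
      finally show ?thesis unfolding ls by (simp add: \<kappa>_def)
    qed
  qed
  also have "\<epsilon> * real (2 * h + 1) ^ d \<le> \<epsilon> * (A * L) ^ d"
    using hA by (intro mult_left_mono power_mono) (auto simp: \<epsilon>_def)
  also have "\<dots> \<le> 1 / 2"
  proof -
    have "2 * A ^ d * L ^ d \<le> exp (2 / \<kappa> * L)" by (rule e2)
    also have "\<dots> \<le> exp (2 / \<kappa> * L ^ d)" using k0 Ld by (simp add: divide_right_mono)
    finally show ?thesis by (simp add: \<epsilon>_def exp_minus power_mult_distrib field_simps)
  qed
  finally have "measure_pmf.prob ?\<mu> {D. \<not> solvable (grid d n) (pebbling_move d q n) D} \<le> 1 / 2" .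
  moreover have "measure_pmf.prob ?\<mu> {D. \<not> solvable (grid d n) (pebbling_move d q n) D}
      = 1 - measure_pmf.prob ?\<mu> {D. solvable (grid d n) (pebbling_move d q n) D}"
    using measure_pmf.prob_compl[of "{D. solvable (grid d n) (pebbling_move d q n) D}" ?\<mu>]
    by (simp add: Collect_neg_eq Compl_eq_Diff_UNIV)
  ultimately show ?thesis using kle unfolding c_def by (intro exI[of _ k]) auto
qed

text \<open>\<open>C\<close> collects the losses in the radius: \<open>s\<close> from the lattice
  sums, 2 for the division by \<open>1 - \<theta>\<close>, \<open>ln 4 + real d * ln A\<close> from
  \<open>(c + 1) / \<eta>\<close>, and a reserve \<open>F\<close>. Lowering the radius by
  \<open>F\<close> lowers the exponent by at least \<open>2 / \<kappa> * F * L ^ d\<close>, which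
  pays for the exponential sum, of order \<open>L ^ d\<close>, and leaves \<open>L ^ d\<close> over:
  hence \<open>X = ln n - L ^ d\<close>.\<close>

lemma prob_solvable_less_half:
  fixes d n k :: nat and q :: "nat \<Rightarrow> nat" and L :: real
  defines "s \<equiv> \<Sum>i=1..d. ln (real (q i))" and "P \<equiv> \<Prod>i=1..d. ln (real (q i))"
  defines "\<kappa> \<equiv> fact (Suc d) * P"
  defines "A \<equiv> 2 * (1 + 1 / ln 2)"
  defines "F \<equiv> \<kappa> * (exp 1 * (2 * A) ^ d + 1) / 2"
  defines "C \<equiv> F + 2 + s + ln 4 + real d * ln A"
  defines "c1 \<equiv> 2 * real (Suc d) / ln 2 * (2 / \<kappa>)"
  assumes d: "1 \<le> d" and q: "\<forall>i\<in>{1..d}. q i \<ge> 2" and L: "2 \<le> L" "F \<le> L" "\<kappa> / 2 \<le> L"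
    and n: "0 < n" "ln (real n) = 2 / \<kappa> * L ^ Suc d"
    and e1: "exp C * L ^ d \<le> exp (1 * L)"
    and e2: "2 * (c1 + 7) * L ^ Suc d \<le> exp (2 / \<kappa> * L)"
    and e3: "2 * (c1 + 7) * (real (2 * Suc d) * (2 / \<kappa>) + 5) * L ^ (2 * Suc d) \<le> exp (1 * L)"
    and k: "real k \<le> real n ^ d * (exp L * exp (- C) / L ^ d)"
  shows "measure_pmf.prob (pmf_of_set (multisets_of_size (grid d n) k))
           {D. solvable (grid d n) (pebbling_move d q n) D} < 1 / 2"
proof -
  have s0: "0 \<le> s" and P0: "0 < P"
    using sum_prod_ln_pos[OF q] by (simp_all add: s_def P_def)
  have k0: "0 < \<kappa>" using P0 by (simp add: \<kappa>_def)
  have A1: "2 \<le> A" by (simp add: A_def)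
  hence Ap: "0 < A" by linarith
  have F0: "0 \<le> F" using k0 A1 by (simp add: F_def)
  have c10: "0 \<le> c1" using k0 by (simp add: c1_def)
  have a: "ln 2 \<le> ln (real (q i))" if "i \<in> {1..d}" for i
  proof -
    have "2 \<le> q i" using q that by auto
    thus ?thesis by simp
  qed
  define c where "c = exp L * exp (- C) / L ^ d"
  text \<open>\<open>\<theta> = 1 / L\<close> changes \<open>b\<close> only by a bounded amount while \<open>\<Sum>w. exp (- \<theta> * \<lambda>(v, w))\<close> stays of
    order \<open>L ^ d\<close>, the order of the number of vertices that matter.\<close>
  define \<theta> where "\<theta> = 1 / L"
  \<comment> \<open>Chosen for \<open>small\<close>, as the exponential sum is at most
    \<open>(A * L) ^ d\<close>. The power \<open>L ^ d\<close> in \<open>1 / \<eta>\<close> cancels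
    the one in \<open>c\<close>, so that \<open>b\<close> stays below \<open>L\<close> by a
    constant.\<close>
  define \<eta> where "\<eta> = 1 / (2 * (A * L) ^ d)"
  define b where "b = ln ((c + 1) / \<eta>)"
  define X where "X = ln (real n) - L ^ d"
  \<comment> \<open>Makes \<open>2 ^ T\<close> exceed \<open>2 * k\<close>, as \<open>k\<close> is
    at most \<open>n ^ Suc d\<close>, while \<open>T\<close> is only of order
    \<open>ln n\<close>.\<close>
  define T where "T = nat \<lceil>real (Suc d) * ln (real n) / ln 2\<rceil> + 2"
  define m where "m = n div (2 * T + 1)"
  have n1: "1 \<le> real n" using n by simp
  have nexp: "real n = exp (2 / \<kappa> * L ^ Suc d)" using n by (metis exp_ln of_nat_0_less_iff)
  have Ld: "L \<le> L ^ d" using L d power_increasing[of 1 d L] by simp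
  have LSd: "L ^ d \<le> L ^ Suc d" using L by (intro power_increasing) auto
  have LS1: "1 \<le> L ^ Suc d" using L by (intro one_le_power) simp
  have theta: "0 < \<theta>" "\<theta> \<le> 1 / 2" using L by (auto simp: \<theta>_def field_simps)
  have eta: "0 < \<eta>" using A1 L by (simp add: \<eta>_def)
  have c1: "1 \<le> c"
  proof -
    have "L ^ d \<le> exp L * exp (- C)" using e1 by (simp add: exp_minus field_simps)
    thus ?thesis using L by (simp add: c_def)
  qed
  have factor_le: "2 * (1 + 1 / (t * ln (real (q i)))) \<le> A * (1 / t)" if i: "i \<in> {1..d}" and t: "0 < t" "t \<le> 1" for i t
  proof -
    have "1 / (t * ln (real (q i))) \<le> 1 / (t * ln 2)"
      using a[OF i] t by (intro divide_left_mono mult_left_mono mult_pos_pos) (auto intro: less_le_trans[of 0 "ln 2"])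
    moreover have "1 \<le> 1 / t" using t by simp
    ultimately have "2 * (1 + 1 / (t * ln (real (q i)))) \<le> 2 * (1 / t + 1 / (t * ln 2))" by simp
    also have "\<dots> = A * (1 / t)" using t by (simp add: A_def field_simps)
    finally show ?thesis .
  qed
  have prod_le: "(\<Prod>i=1..d. 2 * (1 + 1 / (t * ln (real (q i))))) \<le> (A * (1 / t)) ^ d" if t: "0 < t" "t \<le> 1" for t
  proof -
    have "0 \<le> 2 * (1 + 1 / (t * ln (real (q i))))" if "i \<in> {1..d}" for i
      using a[OF that] t by (intro mult_nonneg_nonneg add_nonneg_nonneg divide_nonneg_nonneg) (auto intro: order.trans[of 0 "ln 2"])
    hence "(\<Prod>i=1..d. 2 * (1 + 1 / (t * ln (real (q i))))) \<le> (\<Prod>i=1..d. A * (1 / t))"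
      using factor_le t by (intro prod_mono) auto
    thus ?thesis by simp
  qed
  have small: "\<eta> * (\<Prod>i=1..d. 2 * (1 + 1 / (\<theta> * ln (real (q i))))) \<le> 1 / 2"
  proof -
    have "(\<Prod>i=1..d. 2 * (1 + 1 / (\<theta> * ln (real (q i))))) \<le> (A * L) ^ d"
      using prod_le[of \<theta>] theta by (simp add: \<theta>_def)
    hence "\<eta> * (\<Prod>i=1..d. 2 * (1 + 1 / (\<theta> * ln (real (q i))))) \<le> \<eta> * (A * L) ^ d"
      using eta by (intro mult_left_mono) auto
    also have "\<dots> = 1 / 2" using A1 L by (simp add: \<eta>_def)
    finally show ?thesis .
  qed
  have b_le: "b \<le> L - (F + 2 + s)"
  proof -
    have "(c + 1) / \<eta> \<le> 2 * c / \<eta>" using c1 eta by (intro divide_right_mono) auto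
    also have "\<dots> = 4 * A ^ d * (exp L * exp (- C))"
      using L by (simp add: c_def \<eta>_def power_mult_distrib)
    finally have "b \<le> ln (4 * A ^ d * (exp L * exp (- C)))"
      unfolding b_def using c1 eta by (subst ln_le_cancel_iff) (auto intro!: mult_pos_pos divide_pos_pos zero_less_power Ap)
    also have "4 * A ^ d * (exp L * exp (- C)) = exp (ln 4 + real d * ln A + (L - C))"
      using A1 by (simp add: exp_add exp_diff exp_minus exp_of_nat_mult divide_inverse)
    finally show ?thesis by (simp add: C_def)
  qed
  have X: "2 * (max 0 (b / (1 - \<theta>) + s) ^ Suc d / (fact (Suc d) * P))
        + exp (\<theta> * b) * (\<Prod>i=1..d. 2 * (1 + 1 / (\<theta> * (1 - \<theta>) * ln (real (q i))))) \<le> X"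
  proof -
    have "b / (1 - \<theta>) \<le> (L - (F + 2 + s)) / (1 - \<theta>)"
      using b_le theta by (intro divide_right_mono) auto
    also have "\<dots> \<le> L - (F + s)"
    proof -
      have "(L - (F + s)) * (1 - \<theta>) = L - (F + s) - 1 + \<theta> * (F + s)"
        using L by (simp add: \<theta>_def field_simps)
      also have "\<dots> \<ge> L - (F + 2 + s)"
        using mult_nonneg_nonneg[of \<theta> "F + s"] theta F0 s0 by simp
      finally show ?thesis using theta by (simp add: pos_divide_le_eq)
    qed
    finally have "max 0 (b / (1 - \<theta>) + s) \<le> L - F" using L by simp
    hence "max 0 (b / (1 - \<theta>) + s) ^ Suc d \<le> (L - F) ^ Suc d" by (intro power_mono) auto
    also have "\<dots> = (L - F) * (L - F) ^ d" by simp
    also have "\<dots> \<le> (L - F) * L ^ d" using L F0 by (intro mult_left_mono power_mono) auto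
    finally have "max 0 (b / (1 - \<theta>) + s) ^ Suc d / \<kappa> \<le> (L - F) * L ^ d / \<kappa>"
      using k0 by (intro divide_right_mono) auto
    hence 1: "2 * (max 0 (b / (1 - \<theta>) + s) ^ Suc d / \<kappa>) \<le> 2 / \<kappa> * ((L - F) * L ^ d)" by simp
    have tt: "0 < \<theta> * (1 - \<theta>)" "\<theta> * (1 - \<theta>) \<le> 1" "1 / (\<theta> * (1 - \<theta>)) \<le> 2 * L"
    proof -
      show "0 < \<theta> * (1 - \<theta>)" using theta by (intro mult_pos_pos) auto
      show "\<theta> * (1 - \<theta>) \<le> 1" using theta by (intro mult_le_one) auto
      have "\<theta> * (1 / 2) \<le> \<theta> * (1 - \<theta>)" using theta by (intro mult_left_mono) auto
      hence "1 / (\<theta> * (1 - \<theta>)) \<le> 1 / (\<theta> * (1 / 2))"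
        using theta by (intro divide_left_mono mult_pos_pos) auto
      thus "1 / (\<theta> * (1 - \<theta>)) \<le> 2 * L" by (simp add: \<theta>_def)
    qed
    have "(\<Prod>i=1..d. 2 * (1 + 1 / (\<theta> * (1 - \<theta>) * ln (real (q i))))) \<le> (A * (1 / (\<theta> * (1 - \<theta>)))) ^ d"
      by (rule prod_le[OF tt(1,2)])
    also have "\<dots> \<le> (A * (2 * L)) ^ d"
      using A1 tt by (intro power_mono mult_left_mono mult_nonneg_nonneg) auto
    also have "\<dots> = (2 * A) ^ d * L ^ d" by (simp add: power_mult_distrib)
    finally have 2: "(\<Prod>i=1..d. 2 * (1 + 1 / (\<theta> * (1 - \<theta>) * ln (real (q i))))) \<le> (2 * A) ^ d * L ^ d" .
    have "\<theta> * b \<le> \<theta> * L" using b_le F0 s0 theta by (intro mult_left_mono) auto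
    hence "exp (\<theta> * b) \<le> exp 1" using L by (simp add: \<theta>_def)
    hence "exp (\<theta> * b) * (\<Prod>i=1..d. 2 * (1 + 1 / (\<theta> * (1 - \<theta>) * ln (real (q i)))))
        \<le> exp 1 * ((2 * A) ^ d * L ^ d)"
      using 2 A1 L by (intro order.trans[OF mult_left_mono mult_right_mono]) auto
    hence "2 * (max 0 (b / (1 - \<theta>) + s) ^ Suc d / \<kappa>)
        + exp (\<theta> * b) * (\<Prod>i=1..d. 2 * (1 + 1 / (\<theta> * (1 - \<theta>) * ln (real (q i)))))
        \<le> 2 / \<kappa> * ((L - F) * L ^ d) + exp 1 * ((2 * A) ^ d * L ^ d)"
      using 1 by (rule add_mono[rotated])
    also have "\<dots> = 2 / \<kappa> * L ^ Suc d - (2 / \<kappa> * F - exp 1 * (2 * A) ^ d) * L ^ d"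
      by (simp add: algebra_simps diff_divide_distrib)
    also have "2 / \<kappa> * F = exp 1 * (2 * A) ^ d + 1"
    proof -
      have "2 / \<kappa> * (\<kappa> * z / 2) = z" for z using k0 by simp
      thus ?thesis by (simp only: F_def)
    qed
    finally show ?thesis unfolding \<kappa>_def X_def n(2) by simp
  qed
  have c_le: "c \<le> real n"
  proof -
    have C0: "0 \<le> C" using F0 s0 A1 by (simp add: C_def)
    have "1 \<le> L ^ d" using L by (intro one_le_power) simp
    hence "c \<le> exp L * exp (- C) / 1" unfolding c_def by (intro divide_left_mono) auto
    also have "\<dots> \<le> exp L" using C0 by simp
    also have "L \<le> 2 / \<kappa> * L ^ Suc d"
    proof -
      have "\<kappa> / 2 * L \<le> L * L ^ d" using L Ld by (intro mult_mono) auto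
      thus ?thesis using k0 by (simp add: field_simps)
    qed
    hence "exp L \<le> real n" unfolding nexp by simp
    finally show ?thesis .
  qed
  have kc: "real k \<le> c * real n ^ d" using k by (simp add: c_def mult.commute)
  have kn: "real k \<le> real n ^ Suc d"
    using kc mult_right_mono[OF c_le, of "real n ^ d"] by simp
  have T: "2 * k < 2 ^ T"
  proof -
    have "real (Suc d) * ln (real n) / ln 2 + 2 \<le> real T" unfolding T_def by linarith
    hence "real (Suc d) * ln (real n) + 2 * ln 2 \<le> real T * ln 2" by (simp add: field_simps)
    hence "exp (real (Suc d) * ln (real n) + 2 * ln 2) \<le> exp (real T * ln 2)" by simp
    moreover have "exp (real T * ln 2) = 2 ^ T" by (simp add: exp_of_nat_mult)
    moreover have "exp (real (Suc d) * ln (real n) + 2 * ln 2) = 4 * real n ^ Suc d"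
      using n(1) by (simp add: exp_add exp_of_nat_mult exp_double del: of_nat_Suc)
    ultimately have "4 * real n ^ Suc d \<le> 2 ^ T" by simp
    moreover have "0 < real n ^ Suc d" using n by simp
    ultimately have "2 * real k < 2 ^ T" using kn by linarith
    hence "real (2 * k) < real (2 ^ T)" by simp
    thus ?thesis by (simp only: of_nat_less_iff)
  qed
  have TD: "real (2 * T + 1) \<le> (c1 + 7) * L ^ Suc d"
  proof -
    have "0 \<le> real (Suc d) * ln (real n) / ln 2" using n1 by simp
    hence "real T \<le> real (Suc d) * ln (real n) / ln 2 + 3" unfolding T_def by linarith
    hence "real (2 * T + 1) \<le> 2 * (real (Suc d) * ln (real n) / ln 2) + 7 * 1" by simp
    also have "2 * (real (Suc d) * ln (real n) / ln 2) = c1 * L ^ Suc d"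
      unfolding n(2) c1_def by (simp add: mult_ac del: of_nat_Suc)
    also have "7 * 1 \<le> 7 * L ^ Suc d" using LS1 by (intro mult_left_mono) auto
    finally show ?thesis by (simp add: algebra_simps)
  qed
  have "2 * real (2 * T + 1) \<le> real n"
  proof -
    have "2 * real (2 * T + 1) \<le> 2 * (c1 + 7) * L ^ Suc d"
      unfolding mult.assoc[of 2] using TD by (rule mult_left_mono) simp
    also have "\<dots> \<le> exp (2 / \<kappa> * L)" by (rule e2)
    also have "\<dots> \<le> real n" unfolding nexp using k0 Ld LSd by (simp add: divide_right_mono)
    finally show ?thesis .
  qed
  hence "real (2 * T + 1) \<le> real n" by simp
  hence "2 * T + 1 \<le> n" by (simp only: of_nat_le_iff)
  hence m1: "1 \<le> m" unfolding m_def by (simp add: div_greater_zero_iff Suc_leI)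
  have n_le: "real n \<le> 2 * (real m * real (2 * T + 1))"
  proof -
    have "n < Suc m * (2 * T + 1)" unfolding m_def using dividend_less_div_times[of "2 * T + 1" n] by simp
    also have "\<dots> \<le> (2 * m) * (2 * T + 1)" using m1 by (intro mult_right_mono) auto
    finally have "real n \<le> real ((2 * m) * (2 * T + 1))" by (simp only: of_nat_le_iff less_imp_le)
    thus ?thesis by (simp add: distrib_left)
  qed
  \<comment> \<open>Since \<open>exp (- X) = exp (L ^ d) / n\<close> and \<open>m\<close> is
    \<open>n\<close> up to a factor of order \<open>L ^ Suc d\<close>, the right side is
    \<open>exp (L ^ d)\<close> up to a power of \<open>L\<close>. The left side is made to beat the
    square of \<open>3 * n ^ Suc d\<close>, the cost of passing to geometric counts, with
    \<open>9 * exp (- 5)\<close> remaining.\<close>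
  have main: "real (2 * Suc d) * ln (real n) + 5 \<le> real m * exp (- X)"
  proof -
    have "real (2 * Suc d) * ln (real n) + 5 * 1 \<le> real (2 * Suc d) * (2 / \<kappa> * L ^ Suc d) + 5 * L ^ Suc d"
      unfolding n(2) using LS1 by (intro add_mono order.refl mult_left_mono) auto
    also have "\<dots> = (real (2 * Suc d) * (2 / \<kappa>) + 5) * L ^ Suc d"
      by (simp add: distrib_right)
    finally have "real n * (real (2 * Suc d) * ln (real n) + 5)
        \<le> 2 * (real m * ((c1 + 7) * L ^ Suc d)) * ((real (2 * Suc d) * (2 / \<kappa>) + 5) * L ^ Suc d)"
    proof (intro mult_mono)
      show "real n \<le> 2 * (real m * ((c1 + 7) * L ^ Suc d))"
        using TD by (intro order.trans[OF n_le] mult_left_mono) auto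
    qed (use n1 c10 L in auto)
    also have "\<dots> = real m * (2 * (c1 + 7) * (real (2 * Suc d) * (2 / \<kappa>) + 5) * L ^ (2 * Suc d))"
    proof -
      have "L ^ (2 * Suc d) = L ^ Suc d * L ^ Suc d" by (simp only: mult_2 power_add)
      thus ?thesis by (simp only: mult_ac)
    qed
    also have "\<dots> \<le> real m * exp (L ^ d)"
      using e3 Ld by (intro mult_left_mono) (auto intro: order.trans)
    also have "\<dots> = real n * (real m * exp (- X))"
      using n(1) by (simp add: X_def exp_diff)
    finally show ?thesis using n(1) by simp
  qed
  have "measure_pmf.prob (pmf_of_set (multisets_of_size (grid d n) k))
           {D. solvable (grid d n) (pebbling_move d q n) D}
       \<le> (real (n ^ d + k) + 1)\<^sup>2 * exp (- (real m * exp (- X)))"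
  proof (rule prob_solvable_le[OF d q n(1) _ kc eta theta(1) _ small T])
    show "m * (2 * T + 1) \<le> n" unfolding m_def by (rule div_times_less_eq_dividend)
    show "2 * (max 0 (ln ((c + 1) / \<eta>) / (1 - \<theta>) + (\<Sum>i=1..d. ln (real (q i)))) ^ Suc d /
        (fact (Suc d) * (\<Prod>i=1..d. ln (real (q i))))) +
      exp (\<theta> * ln ((c + 1) / \<eta>)) * (\<Prod>i=1..d. 2 * (1 + 1 / (\<theta> * (1 - \<theta>) * ln (real (q i))))) \<le> X"
      using X unfolding b_def s_def P_def .
  qed (use c1 theta in auto)
  also have "\<dots> \<le> (3 * real n ^ Suc d)\<^sup>2 * exp (- (real (2 * Suc d) * ln (real n) + 5))"
  proof (intro mult_mono power_mono)
    have "real n ^ d \<le> real n ^ Suc d" "1 \<le> real n ^ Suc d"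
      using n1 by (intro power_increasing one_le_power; simp)+
    thus "real (n ^ d + k) + 1 \<le> 3 * real n ^ Suc d" using kn by simp
  qed (use main in auto)
  also have "\<dots> = 9 * exp (- 5)"
  proof -
    have "exp (real (2 * Suc d) * ln (real n)) = real n ^ (2 * Suc d)"
      using n(1) by (simp only: exp_of_nat_mult) simp
    hence "exp (- (real (2 * Suc d) * ln (real n) + 5)) = exp (- 5) / real n ^ (2 * Suc d)"
      by (simp only: minus_add_distrib exp_add exp_minus divide_inverse mult.commute)
    moreover have "(3 * real n ^ Suc d)\<^sup>2 = 9 * real n ^ (2 * Suc d)"
      by (simp add: power_mult_distrib power2_eq_square mult_2 power_add)
    ultimately show ?thesis using n by simp
  qed
  also have "\<dots> < 1 / 2"
  proof -
    have "(2::real) ^ 5 \<le> exp 1 ^ 5" using exp_ge_add_one_self[of 1] by (intro power_mono) auto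
    also have "exp 1 ^ 5 = exp (5::real)" by (simp flip: exp_of_nat_mult)
    finally have "32 \<le> exp (5::real)" by simp
    thus ?thesis by (simp add: exp_minus field_simps)
  qed
  finally show ?thesis .
qed

section \<open>Bounds for all large \<open>n\<close> and the threshold\<close>

lemma eventually_P_half_le:
  fixes d :: nat and q :: "nat \<Rightarrow> nat"
  assumes d: "d \<ge> 1" and q: "\<forall>i\<in>{1..d}. q i \<ge> 2"
  obtains C where "0 < C"
    "\<forall>\<^sub>F n in sequentially. \<exists>k. real k \<le> real n ^ d * (exp (log_scale d q n) * C / log_scale d q n ^ d) \<and>
       1 / 2 \<le> measure_pmf.prob (pmf_of_set (multisets_of_size (grid d n) k))
           {D. solvable (grid d n) (pebbling_move d q n) D}"
proof -
  let ?s = "\<Sum>i=1..d. ln (real (q i))" and ?P = "\<Prod>i=1..d. ln (real (q i))"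
  let ?U = "\<Prod>i=1..d. 2 * (1 + 1 / ln (real (q i)))" and ?\<kappa> = "fact (Suc d) * (\<Prod>i=1..d. ln (real (q i)))"
  let ?K = "exp 1 * (real (\<Sum>i=1..d. q i) * ?U + ?U)"
  define C where "C = max 0 (ln (?K * ?\<kappa> * (?s + 2)) + ?s + 1)"
  define A where "A = 2 * (?s + 2) / ln 2 + 5"
  have k0: "0 < 2 / ?\<kappa>" using sum_prod_ln_pos[OF q] by simp
  have "\<forall>\<^sub>F L in at_top. 1 \<le> L \<and> A * L ^ 1 \<le> exp (2 / ?\<kappa> * L) \<and>
      2 * A ^ d * L ^ d \<le> exp (2 / ?\<kappa> * L) \<and> 1 * L ^ d \<le> exp (1 * L)"
    by (intro eventually_conj eventually_ge_at_top eventually_monomial_le_exp k0) auto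
  hence "\<forall>\<^sub>F n in sequentially. 1 \<le> log_scale d q n \<and> A * log_scale d q n ^ 1 \<le> exp (2 / ?\<kappa> * log_scale d q n) \<and>
      2 * A ^ d * log_scale d q n ^ d \<le> exp (2 / ?\<kappa> * log_scale d q n) \<and>
      1 * log_scale d q n ^ d \<le> exp (1 * log_scale d q n)"
    by (rule eventually_compose_filterlim[OF _ filterlim_log_scale[OF q]])
  hence "\<forall>\<^sub>F n in sequentially. \<exists>k. real k \<le> real n ^ d * (exp (log_scale d q n) * (2 * exp C) / log_scale d q n ^ d) \<and>
       1 / 2 \<le> measure_pmf.prob (pmf_of_set (multisets_of_size (grid d n) k))
           {D. solvable (grid d n) (pebbling_move d q n) D}"
    using eventually_ge_at_top[of 2]
  proof eventually_elim
    case (elim n)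
    have "ln (real n) = 2 / ?\<kappa> * log_scale d q n ^ Suc d"
      unfolding log_scale_power(1)[OF q elim(2)] using k0 by (simp add: field_simps)
    hence "\<exists>k. real k \<le> 2 * (real n ^ d * (exp (log_scale d q n) * exp C / log_scale d q n ^ d)) \<and>
       1 / 2 \<le> measure_pmf.prob (pmf_of_set (multisets_of_size (grid d n) k))
           {D. solvable (grid d n) (pebbling_move d q n) D}"
      unfolding C_def using elim by (intro prob_solvable_ge_half[OF d q]) (auto simp: A_def)
    thus ?case by (simp add: mult_ac)
  qed
  thus ?thesis by (intro that[of "2 * exp C"]) auto
qed

text \<open>Stated for every \<open>k\<close> up to the bound, since the least \<open>k\<close> with
  probability at least \<open>1 / 2\<close> must be kept out of the whole range; for the upper bound
  a single \<open>k\<close> is enough.\<close>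

lemma eventually_less_P_half:
  fixes d :: nat and q :: "nat \<Rightarrow> nat"
  assumes d: "d \<ge> 1" and q: "\<forall>i\<in>{1..d}. q i \<ge> 2"
  obtains C where "0 < C"
    "\<forall>\<^sub>F n in sequentially. \<forall>k. real k \<le> real n ^ d * (exp (log_scale d q n) * C / log_scale d q n ^ d) \<longrightarrow>
       measure_pmf.prob (pmf_of_set (multisets_of_size (grid d n) k))
           {D. solvable (grid d n) (pebbling_move d q n) D} < 1 / 2"
proof -
  let ?s = "\<Sum>i=1..d. ln (real (q i))" and ?\<kappa> = "fact (Suc d) * (\<Prod>i=1..d. ln (real (q i)))"
  define F where "F = ?\<kappa> * (exp 1 * (2 * (2 * (1 + 1 / ln 2))) ^ d + 1) / 2"
  define C where "C = F + 2 + ?s + ln 4 + real d * ln (2 * (1 + 1 / ln 2))"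
  define c1 where "c1 = 2 * real (Suc d) / ln 2 * (2 / ?\<kappa>)"
  let ?B = "2 * (c1 + 7) * (real (2 * Suc d) * (2 / ?\<kappa>) + 5)"
  have k0: "0 < 2 / ?\<kappa>" using sum_prod_ln_pos[OF q] by simp
  have "\<forall>\<^sub>F L in at_top. 2 \<le> L \<and> F \<le> L \<and> ?\<kappa> / 2 \<le> L \<and> exp C * L ^ d \<le> exp (1 * L) \<and>
      2 * (c1 + 7) * L ^ Suc d \<le> exp (2 / ?\<kappa> * L) \<and> ?B * L ^ (2 * Suc d) \<le> exp (1 * L)"
    by (intro eventually_conj eventually_ge_at_top eventually_monomial_le_exp k0) auto
  hence "\<forall>\<^sub>F n in sequentially. 2 \<le> log_scale d q n \<and> F \<le> log_scale d q n \<and> ?\<kappa> / 2 \<le> log_scale d q n \<and>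
      exp C * log_scale d q n ^ d \<le> exp (1 * log_scale d q n) \<and>
      2 * (c1 + 7) * log_scale d q n ^ Suc d \<le> exp (2 / ?\<kappa> * log_scale d q n) \<and>
      ?B * log_scale d q n ^ (2 * Suc d) \<le> exp (1 * log_scale d q n)"
    by (rule eventually_compose_filterlim[OF _ filterlim_log_scale[OF q]])
  hence "\<forall>\<^sub>F n in sequentially. \<forall>k. real k \<le> real n ^ d * (exp (log_scale d q n) * exp (- C) / log_scale d q n ^ d) \<longrightarrow>
       measure_pmf.prob (pmf_of_set (multisets_of_size (grid d n) k))
           {D. solvable (grid d n) (pebbling_move d q n) D} < 1 / 2"
    using eventually_ge_at_top[of 2]
  proof eventually_elim
    case (elim n)
    have ln: "ln (real n) = 2 / ?\<kappa> * log_scale d q n ^ Suc d"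
      unfolding log_scale_power(1)[OF q elim(2)] using k0 by (simp add: field_simps)
    have n: "0 < n" using elim(2) by simp
    show ?case
    proof (intro allI impI)
      fix k assume k: "real k \<le> real n ^ d * (exp (log_scale d q n) * exp (- C) / log_scale d q n ^ d)"
      show "measure_pmf.prob (pmf_of_set (multisets_of_size (grid d n) k))
           {D. solvable (grid d n) (pebbling_move d q n) D} < 1 / 2"
        by (rule prob_solvable_less_half[OF d q _ _ _ n ln])
           (use elim(1) k in \<open>simp_all only: F_def[symmetric] C_def[symmetric] c1_def[symmetric]\<close>)
    qed
  qed
  thus ?thesis by (intro that[of "exp (- C)"]) auto
qed

theorem theorem1:
  fixes d :: nat and q :: "nat \<Rightarrow> nat"
  assumes "d \<ge> 1" and "\<forall>i\<in>{1..d}. q i \<ge> 2"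
  shows "\<exists>E :: nat \<Rightarrow> real. E \<in> O(\<lambda>_. 1) \<and>
    (\<forall>\<^sub>F n in sequentially.
       real (P_half (grid d n) (pebbling_move d q n)) =
         real n ^ d *
         exp ((fact (d + 1) * ln (real n) * (\<Prod>i=1..d. ln (real (q i))) / 2) powr (1 / (real d + 1))
              - real d * ln (ln (real n)) / (real d + 1) + E n))"
proof -
  define Ph where "Ph n = real (P_half (grid d n) (pebbling_move d q n))" for n
  define L where "L n = log_scale d q n" for n
  define \<gamma> where "\<gamma> = ln (fact (Suc d) * (\<Prod>i=1..d. ln (real (q i))) / 2)"
  \<comment> \<open>Defined as the exact error, so that the formula holds identically wherever
    \<open>Ph n > 0\<close> and \<open>n > 0\<close>; what remains is a bound on it.\<close>
  define E where "E n = ln (Ph n / real n ^ d) - (L n - real d * ln (ln (real n)) / (real d + 1))" for n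
  obtain C1 where C1: "0 < C1" and up: "\<forall>\<^sub>F n in sequentially. \<exists>k. real k \<le> real n ^ d * (exp (L n) * C1 / L n ^ d) \<and>
       1 / 2 \<le> measure_pmf.prob (pmf_of_set (multisets_of_size (grid d n) k))
           {D. solvable (grid d n) (pebbling_move d q n) D}"
    using eventually_P_half_le[OF assms] unfolding L_def by blast
  obtain C2 where C2: "0 < C2" and low: "\<forall>\<^sub>F n in sequentially. \<forall>k. real k \<le> real n ^ d * (exp (L n) * C2 / L n ^ d) \<longrightarrow>
       measure_pmf.prob (pmf_of_set (multisets_of_size (grid d n) k))
           {D. solvable (grid d n) (pebbling_move d q n) D} < 1 / 2"
    using eventually_less_P_half[OF assms] unfolding L_def by blast
  define G where "G = real d * \<gamma> / (real d + 1)"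
  let ?B = "\<bar>ln C1\<bar> + \<bar>ln C2\<bar> + \<bar>G\<bar>"
  have ev: "\<forall>\<^sub>F n in sequentially. 0 < Ph n \<and> \<bar>E n\<bar> \<le> ?B"
    using up low eventually_ge_at_top[of 3]
  proof eventually_elim
    case (elim n)
    let ?pr = "\<lambda>k. measure_pmf.prob (pmf_of_set (multisets_of_size (grid d n) k))
           {D. solvable (grid d n) (pebbling_move d q n) D}"
    obtain k where k: "real k \<le> real n ^ d * (exp (L n) * C1 / L n ^ d)" "1 / 2 \<le> ?pr k"
      using elim(1) by blast
    have L0: "0 < L n" unfolding L_def using elim(3) assms(2) by (intro log_scale_power(2)) auto
    have n0: "0 < real n ^ d" using elim(3) by simp
    have Ph: "Ph n = real (LEAST k. 1 / 2 \<le> ?pr k)" by (simp add: Ph_def P_half_def)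
    \<comment> \<open>The \<open>k\<close> from the upper bound shows that the minimum is attained,
      so it cannot lie in the range excluded by the lower bound.\<close>
    have "1 / 2 \<le> ?pr (LEAST k. 1 / 2 \<le> ?pr k)" using k(2) by (rule LeastI)
    hence lower: "real n ^ d * (exp (L n) * C2 / L n ^ d) < Ph n"
      using elim(2) unfolding Ph by (meson not_le)
    have "Ph n \<le> real k" unfolding Ph using k(2) by (simp add: Least_le)
    hence upper: "Ph n \<le> real n ^ d * (exp (L n) * C1 / L n ^ d)" using k(1) by simp
    have pos: "0 < exp (L n) * C / L n ^ d" if "0 < C" for C using L0 that by simp
    have Ph0: "0 < Ph n" using mult_pos_pos[OF n0 pos[OF C2]] lower by simp
    have expand: "ln (exp (L n) * C / L n ^ d) = L n + ln C - real d * ln (L n)" if "0 < C" for C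
      using L0 that by (simp add: ln_div ln_mult ln_realpow)
    have "Ph n / real n ^ d \<le> exp (L n) * C1 / L n ^ d"
      using upper n0 by (simp add: pos_divide_le_eq mult.commute)
    hence u: "ln (Ph n / real n ^ d) \<le> L n + ln C1 - real d * ln (L n)"
      using Ph0 n0 by (subst expand[OF C1, symmetric], intro ln_mono) auto
    have "exp (L n) * C2 / L n ^ d \<le> Ph n / real n ^ d"
      using lower n0 by (simp add: pos_le_divide_eq mult.commute)
    hence l: "L n + ln C2 - real d * ln (L n) \<le> ln (Ph n / real n ^ d)"
      using pos[OF C2] by (subst expand[OF C2, symmetric], intro ln_mono) auto
    have lnn: "0 < ln (real n)" using elim(3) by simp
    \<comment> \<open>\<open>L n ^ Suc d\<close> is a constant times \<open>ln n\<close>, so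
      \<open>d * ln (L n)\<close> is the \<open>log log n\<close> term plus the constant
      \<open>G\<close>.\<close>
    have "real (Suc d) * ln (L n) = ln (L n ^ Suc d)" using L0 by (simp only: ln_realpow)
    also have "\<dots> = ln ((fact (Suc d) * (\<Prod>i=1..d. ln (real (q i))) / 2) * ln (real n))"
      unfolding L_def using elim(3) by (subst log_scale_power(1)[OF assms(2)]) auto
    also have "\<dots> = \<gamma> + ln (ln (real n))"
      unfolding \<gamma>_def using sum_prod_ln_pos(1)[OF assms(2)] lnn by (intro ln_mult_pos) auto
    finally have "ln (L n) = (\<gamma> + ln (ln (real n))) / (real d + 1)" by (simp add: field_simps)
    hence "real d * ln (L n) = real d * \<gamma> / (real d + 1) + real d * ln (ln (real n)) / (real d + 1)"
      by (simp add: algebra_simps add_divide_distrib)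
    moreover define R where "R = real d * ln (ln (real n)) / (real d + 1)"
    ultimately have "real d * ln (L n) = G + R" unfolding G_def by simp
    with u l Ph0 show ?case unfolding E_def R_def[symmetric] by auto
  qed
  have "E \<in> O(\<lambda>_. 1)"
    using ev by (intro bigoI[of _ ?B]) (auto elim: eventually_mono)
  moreover have "\<forall>\<^sub>F n in sequentially. Ph n = real n ^ d *
         exp ((fact (d + 1) * ln (real n) * (\<Prod>i=1..d. ln (real (q i))) / 2) powr (1 / (real d + 1))
              - real d * ln (ln (real n)) / (real d + 1) + E n)"
    using ev eventually_ge_at_top[of 1]
  proof eventually_elim
    case (elim n)
    hence "0 < Ph n / real n ^ d" by simp
    thus ?case using elim(2) by (simp add: E_def L_def log_scale_def)
  qed
  ultimately show ?thesis unfolding Ph_def by blast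
qed

end
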